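(* Fix an integer $r\ge3$ and a real $\beta<1/2$. For any sequence $(n_m)$ of integers with $n_m\ge 2$ and with $n_m\le m^\beta$ for all sufficiently large $m$, $$\frac{\mathcal{Z}^{(n_m)}_{m,r}-\mathbb{E}(\mathcal{Z}^{(n_m)}_{m,r})}{\sqrt{\mathbb{V}(\mathcal{Z}^{(n_m)}_{m,r})}}\ \xrightarrow{\ d\ }\ \mathcal{N}\qquad\text{as } m\to\infty .$$
   Context: For each integer $n\ge1$, $X^{(n)}_1,X^{(n)}_2,\ldots$ is a sequence of independent random variables uniformly distributed in $\{1,\ldots,n\}$, defined on a probability space with probability $\mathbf{P}$; $\mathbb{E}$ and $\mathbb{V}$ denote expectation and variance. For $m\ge r$, $$\mathcal{Z}^{(n)}_{m,r}=\sum_{1\le i_1<\cdots<i_r\le m}\gcd(X^{(n)}_{i_1},\ldots,X^{(n)}_{i_r}).$$ The symbol $\xrightarrow{d}$ means convergence in distribution and $\mathcal{N}$ is a standard normal variable. *)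

theory Defs
  imports "HOL-Probability.Probability"
begin

text \<open>
  Strictly increasing index tuples i_1 < ... < i_r in {1..m} are encoded as the r-element
  subsets of {1..m}. The argument Y is one sequence of random variables, of which only the
  values at indices from 1 on are used.
\<close>

definition gcd_sum :: "(nat \<Rightarrow> 'a \<Rightarrow> nat) \<Rightarrow> nat \<Rightarrow> nat \<Rightarrow> 'a \<Rightarrow> real" where
  "gcd_sum Y m r \<omega> = (\<Sum>I | I \<subseteq> {1..m} \<and> card I = r. real (GCD i\<in>I. Y i \<omega>))"

end

theory Submission
  imports Defs "HOL-Number_Theory.Totient"
begin

text \<open>
  Fix \<open>m\<close>, write \<open>N\<close> for the range parameter, and put
  \<open>h(x) = E gcd(x, X_2, \<dots>, X_r)\<close>, \<open>\<theta> = E h(X_1)\<close> and \<open>\<zeta> = V h(X_1)\<close>.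
  An index lies in \<open>c = binom(m - 1, r - 1)\<close> of the \<open>r\<close>-subsets of \<open>{1..m}\<close>, so the
  orthogonal projection of the centred gcd sum onto sums of functions of single variables is
  \<open>L = c * (\<Sum>i. h(X_i) - \<theta>)\<close>. The proof shows that the rest of the sum is negligible,
  and that \<open>L\<close> satisfies a central limit theorem. Both are measured by \<open>N\<^sup>2 / m\<close>,
  which tends to 0 because \<open>\<beta> < 1/2\<close>.

  Three crude bounds in \<open>N\<close> suffice. First, \<open>\<zeta>\<close> is at least a constant over \<open>N\<close>
  (\<open>gcd_proj_var_ge\<close>): the values 1 and 2 each have probability \<open>1/N\<close>, and \<open>h(2)\<close> exceeds
  \<open>h(1)\<close> by at least a constant depending only on \<open>r\<close>. Second, the gcd of at least two of the
  variables has second moment at most \<open>N\<close> (\<open>expectation_gcd_kernel_square_le\<close>),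
  because \<open>d\<close> divides all of them with probability at most \<open>1/d\<^sup>2\<close>. Third, \<open>\<bar>h(x) - \<theta>\<bar> \<le> 2 * sqrt N\<close> when \<open>r \<ge> 3\<close>
  (\<open>gcd_proj_deviation_le\<close>).

  The covariance of the gcds over two \<open>r\<close>-subsets vanishes if they are disjoint, equals
  \<open>\<zeta>\<close> if they share one index, and is at most \<open>N\<close> otherwise. The pairs sharing one index
  account for at most the variance of \<open>L\<close>, and counting the others shows that the variance of the
  gcd sum is at most \<open>1 + N (r - 1)\<^sup>2 / ((m - 1) \<zeta>)\<close> times that of \<open>L\<close>
  (\<open>variance_ratio_le\<close>). By orthogonality the two normalized variables are then close in
  mean square, hence so are their characteristic functions.

  Since \<open>N\<close> changes with \<open>m\<close>, the summands of \<open>L\<close> form a triangular array. The normalized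
  summands are bounded by \<open>2 * sqrt N / sqrt (m \<zeta>)\<close>, which is of order at most \<open>N / sqrt m\<close>, and a
  third order Taylor estimate in terms of this bound compares the characteristic function of the
  normalized \<open>L\<close> with \<open>(1 - t\<^sup>2 / (2 m)) ^ m\<close> (\<open>char_sum_bounded_approx\<close>).
  Levy's continuity theorem concludes.

  All moments are computed from \<open>g = (\<Sum>d | d dvd g. totient d)\<close>, which turns a gcd into a
  linear combination of products of functions of independent variables.
\<close>

section \<open>Characteristic functions\<close>

lemma norm_iexp_diff_le: "cmod (iexp a - iexp b) \<le> \<bar>a - b\<bar>"
proof -
  have "iexp a - iexp b = iexp b * (iexp (a - b) - 1)"
    by (simp add: exp_diff field_simps)
  then have "cmod (iexp a - iexp b) = cmod (iexp (a - b) - 1)"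
    by (simp add: norm_mult)
  then show ?thesis
    using iexp_approx1[of "a - b" 0] by simp
qed

text \<open>
  The function \<open>iexp\<close> is 1-Lipschitz, and the first absolute moment is at most the root of the second
  moment.
\<close>
lemma (in prob_space) char_distr_diff_le:
  fixes U V :: "'a \<Rightarrow> real"
  assumes [measurable]: "random_variable borel U" "random_variable borel V"
    and sq: "integrable M (\<lambda>\<omega>. (U \<omega> - V \<omega>)\<^sup>2)"
  shows "cmod (char (distr M borel U) t - char (distr M borel V) t)
           \<le> \<bar>t\<bar> * sqrt (expectation (\<lambda>\<omega>. (U \<omega> - V \<omega>)\<^sup>2))"
proof -
  have int: "integrable M (\<lambda>\<omega>. \<bar>U \<omega> - V \<omega>\<bar>)"
    by (rule integrable_abs[OF square_integrable_imp_integrable[OF _ sq]]) measurable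
  have "(expectation (\<lambda>\<omega>. \<bar>U \<omega> - V \<omega>\<bar>))\<^sup>2 \<le> expectation (\<lambda>\<omega>. (U \<omega> - V \<omega>)\<^sup>2)"
    using variance_positive[of "\<lambda>\<omega>. \<bar>U \<omega> - V \<omega>\<bar>"] variance_eq[OF int] sq by simp
  then have *: "expectation (\<lambda>\<omega>. \<bar>U \<omega> - V \<omega>\<bar>) \<le> sqrt (expectation (\<lambda>\<omega>. (U \<omega> - V \<omega>)\<^sup>2))"
    by (rule real_le_rsqrt)
  have int_iexp: "integrable M (\<lambda>\<omega>. iexp (t * W \<omega>))" if "random_variable borel W" for W
    using that by (intro integrable_const_bound[of _ 1]) auto
  have "char (distr M borel U) t - char (distr M borel V) t
          = (\<integral>\<omega>. (iexp (t * U \<omega>) - iexp (t * V \<omega>)) \<partial>M)"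
    unfolding char_def using int_iexp[of U] int_iexp[of V] by (simp add: integral_distr)
  also have "cmod \<dots> \<le> expectation (\<lambda>\<omega>. cmod (iexp (t * U \<omega>) - iexp (t * V \<omega>)))"
    by (rule integral_norm_bound)
  also have "\<dots> \<le> expectation (\<lambda>\<omega>. \<bar>t\<bar> * \<bar>U \<omega> - V \<omega>\<bar>)"
  proof (rule integral_mono)
    show "integrable M (\<lambda>\<omega>. cmod (iexp (t * U \<omega>) - iexp (t * V \<omega>)))"
      by (intro integrable_norm Bochner_Integration.integrable_diff int_iexp) simp_all
    show "integrable M (\<lambda>\<omega>. \<bar>t\<bar> * \<bar>U \<omega> - V \<omega>\<bar>)"
      using int by simp
    show "cmod (iexp (t * U \<omega>) - iexp (t * V \<omega>)) \<le> \<bar>t\<bar> * \<bar>U \<omega> - V \<omega>\<bar>" for \<omega>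
      using norm_iexp_diff_le[of "t * U \<omega>" "t * V \<omega>"]
      by (simp add: right_diff_distrib[symmetric] abs_mult)
  qed
  also have "\<dots> \<le> \<bar>t\<bar> * sqrt (expectation (\<lambda>\<omega>. (U \<omega> - V \<omega>)\<^sup>2))"
    using * by (simp add: mult_left_mono)
  finally show ?thesis .
qed

text \<open>
  If \<open>V\<close> is an orthogonal projection of \<open>U\<close>, the angle between them is given by the ratio of their
  norms alone, so an upper bound for the second moment of \<open>U\<close> controls the distance of the
  normalized variables, even though they are normalized differently.
\<close>
lemma (in prob_space) normalized_projection_distance:
  fixes U V :: "'a \<Rightarrow> real"
  assumes int: "integrable M (\<lambda>\<omega>. (U \<omega>)\<^sup>2)" "integrable M (\<lambda>\<omega>. (V \<omega>)\<^sup>2)"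
      "integrable M (\<lambda>\<omega>. U \<omega> * V \<omega>)"
    and proj: "expectation (\<lambda>\<omega>. U \<omega> * V \<omega>) = expectation (\<lambda>\<omega>. (V \<omega>)\<^sup>2)"
    and pos: "expectation (\<lambda>\<omega>. (V \<omega>)\<^sup>2) > 0"
  defines "a \<equiv> expectation (\<lambda>\<omega>. (U \<omega>)\<^sup>2)" and "b \<equiv> expectation (\<lambda>\<omega>. (V \<omega>)\<^sup>2)"
  shows "integrable M (\<lambda>\<omega>. (U \<omega> / sqrt a - V \<omega> / sqrt b)\<^sup>2)"
    and "expectation (\<lambda>\<omega>. (U \<omega> / sqrt a - V \<omega> / sqrt b)\<^sup>2) \<le> 2 * (a / b - 1)"
proof -
  have "0 \<le> expectation (\<lambda>\<omega>. (U \<omega> - V \<omega>)\<^sup>2)" by simp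
  also have "\<dots> = expectation (\<lambda>\<omega>. (U \<omega>)\<^sup>2 + (V \<omega>)\<^sup>2 - 2 * (U \<omega> * V \<omega>))"
    by (simp add: power2_diff mult.assoc)
  also have "\<dots> = a - b"
    using int proj by (simp add: a_def b_def)
  finally have ba: "b \<le> a" by simp
  have b: "b > 0" using pos by (simp add: b_def)
  have a: "a > 0" using ba b by simp
  have eq: "(\<lambda>\<omega>. (U \<omega> / sqrt a - V \<omega> / sqrt b)\<^sup>2)
      = (\<lambda>\<omega>. (U \<omega>)\<^sup>2 / a + (V \<omega>)\<^sup>2 / b - 2 / (sqrt a * sqrt b) * (U \<omega> * V \<omega>))"
    using a b by (auto simp: power2_diff power_divide fun_eq_iff)
  show "integrable M (\<lambda>\<omega>. (U \<omega> / sqrt a - V \<omega> / sqrt b)\<^sup>2)"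
    unfolding eq using int by simp
  define s where "s = sqrt (b / a)"
  have s: "0 < s" "s \<le> 1" "s\<^sup>2 = b / a" using a b ba by (auto simp: s_def)
  have "expectation (\<lambda>\<omega>. (U \<omega> / sqrt a - V \<omega> / sqrt b)\<^sup>2) = 2 - 2 / (sqrt a * sqrt b) * b"
    unfolding eq using int proj a b by (simp add: a_def[symmetric] b_def[symmetric])
  also have "2 / (sqrt a * sqrt b) * b = 2 * s"
    using a b by (simp add: s_def real_sqrt_divide field_simps)
  also have "2 - 2 * s \<le> 2 * (a / b - 1)"
  proof -
    have "s\<^sup>2 \<le> s" unfolding power2_eq_square using s(1,2) by (simp add: mult_left_le)
    \<comment> \<open>With \<open>q * s\<^sup>2 = 1\<close>, the inequality \<open>s\<^sup>2 + q \<ge> 2\<close> is a form of AM-GM.\<close>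
    define q where "q = a / b"
    have q: "1 \<le> q" "q * s\<^sup>2 = 1" using ba b a s(3) by (simp_all add: q_def)
    have "0 \<le> (q - 1) * (1 - s\<^sup>2)"
      using q s(1,2) by (intro mult_nonneg_nonneg) (auto simp: power_le_one)
    also have "\<dots> = q - 2 + s\<^sup>2"
      using q(2) by (simp add: algebra_simps)
    finally show ?thesis
      using \<open>s\<^sup>2 \<le> s\<close> unfolding q_def[symmetric] by argo
  qed
  finally show "expectation (\<lambda>\<omega>. (U \<omega> / sqrt a - V \<omega> / sqrt b)\<^sup>2) \<le> 2 * (a / b - 1)" .
qed

text \<open>
  A quantitative central limit theorem: the error involves the summands only through their uniform
  bound \<open>\<delta>\<close>, so it applies along the rows of a triangular array. Each factor of the
  characteristic function differs from its second order Taylor polynomial by a third moment, which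
  is at most \<open>\<delta>\<close> times the variance \<open>1/m\<close>; the \<open>m\<close> errors add up because all factors
  have modulus at most 1.
\<close>
lemma (in prob_space) char_sum_bounded_approx:
  fixes Y :: "'i \<Rightarrow> 'a \<Rightarrow> real" and t \<delta> :: real
  assumes indep: "indep_vars (\<lambda>_. borel) Y A" and A: "finite A" "A \<noteq> {}"
    and mean: "\<And>i. i \<in> A \<Longrightarrow> expectation (Y i) = 0"
    and var: "\<And>i. i \<in> A \<Longrightarrow> expectation (\<lambda>\<omega>. (Y i \<omega>)\<^sup>2) = 1 / card A"
    and bound: "\<And>i \<omega>. i \<in> A \<Longrightarrow> \<bar>Y i \<omega>\<bar> \<le> \<delta>"
    and t: "t\<^sup>2 \<le> 4 * card A"
  shows "cmod (char (distr M borel (\<lambda>\<omega>. \<Sum>i\<in>A. Y i \<omega>)) t - complex_of_real ((1 + (- t\<^sup>2 / 2) / card A) ^ card A))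
           \<le> \<bar>t\<bar> ^ 3 * \<delta> / 6"
proof -
  define m where "m = real (card A)"
  have m: "m > 0" using A by (simp add: m_def card_gt_0_iff)
  have rv[measurable]: "random_variable borel (Y i)" if "i \<in> A" for i
    using indep that by (simp add: indep_vars_def2)
  have int: "integrable M (Y i)" "integrable M (\<lambda>\<omega>. (Y i \<omega>)\<^sup>2)" if "i \<in> A" for i
  proof -
    note [measurable] = rv[OF that]
    show "integrable M (Y i)"
      using bound[OF that] by (intro integrable_const_bound[of _ \<delta>]) auto
    have "(Y i \<omega>)\<^sup>2 \<le> \<delta>\<^sup>2" for \<omega>
      using bound[OF that, of \<omega>] by (metis power2_abs power_mono abs_ge_zero)
    then show "integrable M (\<lambda>\<omega>. (Y i \<omega>)\<^sup>2)"
      by (intro integrable_const_bound[of _ "\<delta>\<^sup>2"]) auto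
  qed
  define z where "z = complex_of_real (1 + (- t\<^sup>2 / 2) / m)"
  have one: "cmod (char (distr M borel (Y i)) t - z) \<le> \<bar>t\<bar> ^ 3 * \<delta> / 6 / m" if i: "i \<in> A" for i
  proof -
    note [measurable] = rv[OF i]
    have "cmod (char (distr M borel (Y i)) t - (1 - t\<^sup>2 * (1 / m) / 2))
        \<le> t\<^sup>2 / 6 * expectation (\<lambda>\<omega>. min (6 * (Y i \<omega>)\<^sup>2) (\<bar>t\<bar> * \<bar>Y i \<omega>\<bar> ^ 3))"
      using int[OF i] mean[OF i] var[OF i]
      by (intro char_approx3') (auto simp: m_def)
    also have "\<dots> \<le> t\<^sup>2 / 6 * expectation (\<lambda>\<omega>. \<bar>t\<bar> * \<delta> * (Y i \<omega>)\<^sup>2)"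
    proof (intro mult_left_mono integral_mono)
      show "min (6 * (Y i \<omega>)\<^sup>2) (\<bar>t\<bar> * \<bar>Y i \<omega>\<bar> ^ 3) \<le> \<bar>t\<bar> * \<delta> * (Y i \<omega>)\<^sup>2" for \<omega>
      proof -
        have "\<bar>Y i \<omega>\<bar> ^ 3 = \<bar>Y i \<omega>\<bar> * (Y i \<omega>)\<^sup>2"
          by (simp add: power3_eq_cube power2_eq_square)
        also have "\<dots> \<le> \<delta> * (Y i \<omega>)\<^sup>2"
          using bound[OF i] by (intro mult_right_mono) auto
        finally have "\<bar>t\<bar> * \<bar>Y i \<omega>\<bar> ^ 3 \<le> \<bar>t\<bar> * (\<delta> * (Y i \<omega>)\<^sup>2)"
          by (intro mult_left_mono) auto
        then show ?thesis by (simp add: min.coboundedI2 mult.assoc)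
      qed
      show "integrable M (\<lambda>\<omega>. min (6 * (Y i \<omega>)\<^sup>2) (\<bar>t\<bar> * \<bar>Y i \<omega>\<bar> ^ 3))"
        by (rule Bochner_Integration.integrable_bound[where f = "\<lambda>\<omega>. 6 * (Y i \<omega>)\<^sup>2"])
           (use int[OF i] in \<open>auto simp: min_def\<close>)
      show "integrable M (\<lambda>\<omega>. \<bar>t\<bar> * \<delta> * (Y i \<omega>)\<^sup>2)"
        using int[OF i] by simp
    qed simp
    also have "\<dots> = \<bar>t\<bar> ^ 3 * \<delta> / 6 / m"
      using var[OF i] by (simp add: m_def power3_eq_cube power2_eq_square)
    finally show ?thesis by (simp add: z_def field_simps)
  qed
  have "\<bar>1 + (- t\<^sup>2 / 2) / m\<bar> \<le> 1"
    using t m by (intro abs_leI) (auto simp: field_simps m_def)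
  then have z: "cmod z \<le> 1"
    by (simp only: z_def norm_of_real)
  have "cmod (char (distr M borel (\<lambda>\<omega>. \<Sum>i\<in>A. Y i \<omega>)) t - z ^ card A)
      = cmod ((\<Prod>i\<in>A. char (distr M borel (Y i)) t) - (\<Prod>i\<in>A. z))"
    using char_distr_sum[OF indep, of t] by simp
  also have "\<dots> \<le> (\<Sum>i\<in>A. cmod (char (distr M borel (Y i)) t - z))"
  proof (rule norm_prod_diff)
    fix i assume i: "i \<in> A"
    show "cmod (char (distr M borel (Y i)) t) \<le> 1"
      by (intro real_distribution.cmod_char_le_1 real_distribution_distr rv i)
  qed (rule z)
  also have "\<dots> \<le> (\<Sum>i\<in>A. \<bar>t\<bar> ^ 3 * \<delta> / 6 / m)"
    by (intro sum_mono one)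
  also have "\<dots> = \<bar>t\<bar> ^ 3 * \<delta> / 6"
    using m by (simp add: m_def)
  finally show ?thesis by (simp add: z_def m_def)
qed

section \<open>Counting pairs of subsets\<close>

lemma card_subsets_containing:
  assumes "finite A" "B \<subseteq> A" "card B \<le> r"
  shows "card {I. I \<subseteq> A \<and> card I = r \<and> B \<subseteq> I} = (card A - card B) choose (r - card B)"
proof -
  have fB: "finite B" using assms finite_subset by blast
  have "bij_betw (\<lambda>I. I - B) {I. I \<subseteq> A \<and> card I = r \<and> B \<subseteq> I}
          {K. K \<subseteq> A - B \<and> card K = r - card B}"
  proof (rule bij_betw_byWitness[where f' = "\<lambda>K. K \<union> B"])
    show "(\<lambda>K. K \<union> B) ` {K. K \<subseteq> A - B \<and> card K = r - card B} \<subseteq> {I. I \<subseteq> A \<and> card I = r \<and> B \<subseteq> I}"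
    proof clarify
      fix K assume K: "K \<subseteq> A - B" "card K = r - card B"
      have "card (K \<union> B) = card K + card B"
        using K assms fB by (intro card_Un_disjoint) (auto intro: finite_subset)
      then show "K \<union> B \<subseteq> A \<and> card (K \<union> B) = r \<and> B \<subseteq> K \<union> B"
        using K assms by auto
    qed
  qed (use fB in \<open>auto simp: card_Diff_subset\<close>)
  then have "card {I. I \<subseteq> A \<and> card I = r \<and> B \<subseteq> I} = card {K. K \<subseteq> A - B \<and> card K = r - card B}"
    by (rule bij_betw_same_card)
  also have "\<dots> = (card A - card B) choose (r - card B)"
    using assms fB by (simp add: n_subsets card_Diff_subset)
  finally show ?thesis .
qed

lemma sum_subsets_indicator:
  assumes A: "finite A" "B \<subseteq> A" "card B \<le> r"
  shows "(\<Sum>I | I \<subseteq> A \<and> card I = r. of_bool (B \<subseteq> I)) = real ((card A - card B) choose (r - card B))"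
proof -
  have fin: "finite {I. I \<subseteq> A \<and> card I = r}" using A by simp
  have "{I. I \<subseteq> A \<and> card I = r} \<inter> {I. B \<subseteq> I} = {I. I \<subseteq> A \<and> card I = r \<and> B \<subseteq> I}" by auto
  then show ?thesis
    using sum.inter_filter[OF fin, of "\<lambda>_. 1::real" "\<lambda>I. B \<subseteq> I"] card_subsets_containing[OF A]
    by (simp add: of_bool_def Collect_conj_eq Int_assoc)
qed

lemma card_Int_eq_sum:
  assumes "finite A" "I \<subseteq> A"
  shows "real (card (I \<inter> J)) = (\<Sum>i\<in>A. of_bool (i \<in> I) * of_bool (i \<in> J))"
proof -
  have "(\<Sum>i\<in>A. of_bool (i \<in> I) * of_bool (i \<in> J)) = (\<Sum>i\<in>A. if i \<in> I \<inter> J then 1 else (0::real))"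
    by (intro sum.cong) auto
  also have "\<dots> = real (card (A \<inter> (I \<inter> J)))"
    using assms by (subst sum.inter_restrict[symmetric]) auto
  also have "A \<inter> (I \<inter> J) = I \<inter> J" using assms by auto
  finally show ?thesis by simp
qed

text \<open>
  Double counting: each element of \<open>A\<close>, respectively each ordered pair of distinct elements,
  contributes the square of the number of \<open>r\<close>-subsets that contain it.
\<close>
lemma sum_card_Int_subsets:
  fixes A :: "'b set" and r :: nat
  assumes A: "finite A" and r: "r \<ge> 2"
  defines "\<I> \<equiv> {I. I \<subseteq> A \<and> card I = r}"
  shows "(\<Sum>I\<in>\<I>. \<Sum>J\<in>\<I>. real (card (I \<inter> J)))
           = card A * (real ((card A - 1) choose (r - 1)))\<^sup>2" (is "?S1 = _")
    and "(\<Sum>I\<in>\<I>. \<Sum>J\<in>\<I>. real (card (I \<inter> J)) * (real (card (I \<inter> J)) - 1))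
           = card A * real (card A - 1) * (real ((card A - 2) choose (r - 2)))\<^sup>2" (is "?S2 = _")
proof -
  define c1 c2 where "c1 = real ((card A - 1) choose (r - 1))" and "c2 = real ((card A - 2) choose (r - 2))"
  define e where "e i j I = (of_bool (i \<in> I) * of_bool (j \<in> I) :: real)" for i j :: 'b and I
  have e_eq: "(\<Sum>I\<in>\<I>. e i j I) = (if i = j then c1 else c2)" if "i \<in> A" "j \<in> A" for i j
  proof -
    have "(\<Sum>I\<in>\<I>. e i j I) = (\<Sum>I\<in>\<I>. of_bool ({i, j} \<subseteq> I))"
      by (intro sum.cong) (auto simp: e_def)
    also have "\<dots> = real ((card A - card {i, j}) choose (r - card {i, j}))"
      unfolding \<I>_def using that A r by (intro sum_subsets_indicator) (auto simp: card_insert_if)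
    finally show ?thesis by (auto simp: c1_def c2_def numeral_2_eq_2)
  qed
  have "?S1 = (\<Sum>I\<in>\<I>. \<Sum>J\<in>\<I>. \<Sum>i\<in>A. e i i I * e i i J)"
  proof (intro sum.cong refl)
    fix I J assume "I \<in> \<I>" "J \<in> \<I>"
    then show "real (card (I \<inter> J)) = (\<Sum>i\<in>A. e i i I * e i i J)"
      using card_Int_eq_sum[OF A, of I J] by (simp add: \<I>_def e_def of_bool_conj[symmetric] del: of_bool_conj)
  qed
  also have "\<dots> = (\<Sum>i\<in>A. \<Sum>I\<in>\<I>. \<Sum>J\<in>\<I>. e i i I * e i i J)"
    by (subst sum.swap[of _ A], subst sum.swap[of _ A]) (rule refl)
  also have "\<dots> = (\<Sum>i\<in>A. (\<Sum>I\<in>\<I>. e i i I) * (\<Sum>J\<in>\<I>. e i i J))"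
    by (simp add: sum_product)
  also have "\<dots> = card A * c1\<^sup>2"
    by (simp add: e_eq power2_eq_square)
  finally show S1: "?S1 = card A * (real ((card A - 1) choose (r - 1)))\<^sup>2" by (simp add: c1_def)
  have "(\<Sum>I\<in>\<I>. \<Sum>J\<in>\<I>. real (card (I \<inter> J)) * real (card (I \<inter> J)))
     = (\<Sum>I\<in>\<I>. \<Sum>J\<in>\<I>. \<Sum>i\<in>A. \<Sum>j\<in>A. e i j I * e i j J)"
  proof (intro sum.cong refl)
    fix I J assume "I \<in> \<I>" "J \<in> \<I>"
    then have "I \<subseteq> A" by (auto simp: \<I>_def)
    then show "real (card (I \<inter> J)) * real (card (I \<inter> J)) = (\<Sum>i\<in>A. \<Sum>j\<in>A. e i j I * e i j J)"
      using A by (simp only: card_Int_eq_sum[of A] sum_product e_def) (simp add: mult_ac)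
  qed
  also have "\<dots> = (\<Sum>i\<in>A. \<Sum>j\<in>A. \<Sum>I\<in>\<I>. \<Sum>J\<in>\<I>. e i j I * e i j J)"
    by (simp only: sum.swap[of _ A \<I>])
  also have "\<dots> = (\<Sum>i\<in>A. \<Sum>j\<in>A. (\<Sum>I\<in>\<I>. e i j I) * (\<Sum>J\<in>\<I>. e i j J))"
    by (simp add: sum_product)
  also have "\<dots> = (\<Sum>i\<in>A. \<Sum>j\<in>A. if i = j then c1\<^sup>2 else c2\<^sup>2)"
    by (intro sum.cong refl) (auto simp: e_eq power2_eq_square)
  also have "\<dots> = (\<Sum>i\<in>A. c1\<^sup>2 + (card A - 1) * c2\<^sup>2)"
  proof (intro sum.cong refl)
    fix i assume i: "i \<in> A"
    have "(\<Sum>j\<in>A - {i}. if i = j then c1\<^sup>2 else c2\<^sup>2) = (\<Sum>j\<in>A - {i}. c2\<^sup>2)"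
      by (intro sum.cong) auto
    then show "(\<Sum>j\<in>A. if i = j then c1\<^sup>2 else c2\<^sup>2) = c1\<^sup>2 + (card A - 1) * c2\<^sup>2"
      using A i by (simp add: sum.remove[of A i])
  qed
  also have "\<dots> = card A * c1\<^sup>2 + card A * (card A - 1) * c2\<^sup>2"
    by (simp only: sum_constant distrib_left of_nat_mult mult.assoc)
  finally show "?S2 = card A * real (card A - 1) * (real ((card A - 2) choose (r - 2)))\<^sup>2"
    using S1 by (simp add: right_diff_distrib sum_subtractf c1_def c2_def)
qed

section \<open>The gcd through its divisors\<close>

definition avg :: "nat \<Rightarrow> (nat \<Rightarrow> real) \<Rightarrow> real" where
  "avg N f = (\<Sum>x = 1..N. f x) / N"

definition dvd_ind :: "nat \<Rightarrow> nat \<Rightarrow> real" where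
  "dvd_ind d x = of_bool (d dvd x)"

abbreviation dvd_freq :: "nat \<Rightarrow> nat \<Rightarrow> real" where
  "dvd_freq N d \<equiv> avg N (dvd_ind d)"

text \<open>
  For nonempty finite \<open>I\<close> this is the gcd of the values of \<open>x\<close> on \<open>I\<close> as long as these lie in
  \<open>{1..N}\<close> (\<open>gcd_kernel_eq_Gcd\<close>). As opposed to the gcd, it is bounded for arbitrary values and
  a linear combination of products over \<open>I\<close>.
\<close>
definition gcd_kernel :: "nat \<Rightarrow> nat set \<Rightarrow> (nat \<Rightarrow> nat) \<Rightarrow> real" where
  "gcd_kernel N I x = (\<Sum>d = 1..N. totient d * (\<Prod>i\<in>I. dvd_ind d (x i)))"

definition gcd_mean :: "nat \<Rightarrow> nat \<Rightarrow> real" where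
  "gcd_mean N r = (\<Sum>d = 1..N. totient d * dvd_freq N d ^ r)"

text \<open>
  The conditional expectation of the gcd of \<open>r\<close> uniform variables given that one of them is \<open>x\<close>,
  for \<open>x\<close> in \<open>{1..N}\<close>: the condition replaces one of the \<open>r\<close> factors \<open>dvd_freq N d\<close> by the indicator of \<open>d dvd x\<close>.
\<close>
definition gcd_proj :: "nat \<Rightarrow> nat \<Rightarrow> nat \<Rightarrow> real" where
  "gcd_proj N r x = (\<Sum>d = 1..N. totient d * dvd_freq N d ^ (r - 1) * dvd_ind d x)"

definition gcd_proj_var :: "nat \<Rightarrow> nat \<Rightarrow> real" where
  "gcd_proj_var N r = avg N (\<lambda>x. (gcd_proj N r x - gcd_mean N r)\<^sup>2)"

lemma dvd_ind_bounds: "0 \<le> dvd_ind d x" "dvd_ind d x \<le> 1"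
  by (simp_all add: dvd_ind_def)

lemma avg_mono: "(\<And>x. f x \<le> g x) \<Longrightarrow> avg N f \<le> avg N g"
  unfolding avg_def by (intro divide_right_mono sum_mono) auto

lemma avg_const: "N \<ge> 1 \<Longrightarrow> avg N (\<lambda>_. c) = c"
  by (simp add: avg_def)

lemma avg_sum: "avg N (\<lambda>x. \<Sum>d\<in>D. f d x) = (\<Sum>d\<in>D. avg N (f d))"
  by (simp add: avg_def sum.swap[of _ D] sum_divide_distrib)

lemma avg_cmult: "avg N (\<lambda>x. c * f x) = c * avg N f"
  by (simp add: avg_def sum_distrib_left)

lemma avg_add: "avg N (\<lambda>x. f x + g x) = avg N f + avg N g"
  by (simp add: avg_def sum.distrib add_divide_distrib)

lemma avg_diff: "avg N (\<lambda>x. f x - g x) = avg N f - avg N g"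
  by (simp add: avg_def sum_subtractf diff_divide_distrib)

lemma dvd_freq_eq:
  assumes "d \<ge> 1"
  shows "dvd_freq N d = real (N div d) / N"
proof -
  have "bij_betw (\<lambda>k. d * k) {1..N div d} {x \<in> {1..N}. d dvd x}"
    using assms
    by (intro bij_betwI[where g = "\<lambda>x. x div d"])
       (auto simp: less_eq_div_iff_mult_less_eq mult.commute elim!: dvdE)
  then have "card {x \<in> {1..N}. d dvd x} = N div d"
    by (simp add: bij_betw_same_card[symmetric])
  moreover have "(\<Sum>x = 1..N. dvd_ind d x) = real (card {x \<in> {1..N}. d dvd x})"
    using sum.inter_filter[of "{1..N}" "\<lambda>_. 1::real" "\<lambda>x. d dvd x"] by (simp add: dvd_ind_def of_bool_def)
  ultimately show ?thesis by (simp add: avg_def)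
qed

lemma dvd_freq_bounds:
  assumes "d \<ge> 1"
  shows "0 \<le> dvd_freq N d" "dvd_freq N d \<le> 1" "dvd_freq N d \<le> 1 / d"
proof -
  have *: "real (N div d) \<le> N / d" by (rule of_nat_div_le_of_nat)
  show 0: "0 \<le> dvd_freq N d" using assms by (simp add: dvd_freq_eq)
  show 1: "dvd_freq N d \<le> 1 / d"
    using * assms by (cases "N = 0") (auto simp: dvd_freq_eq divide_simps)
  have "1 / real d \<le> 1" using assms by simp
  with 1 show "dvd_freq N d \<le> 1" by linarith
qed

lemma dvd_freq_power_le:
  assumes "d \<ge> 1" "k \<ge> 2"
  shows "dvd_freq N d ^ k \<le> 1 / (real d)\<^sup>2"
proof -
  have "dvd_freq N d ^ k \<le> dvd_freq N d ^ 2"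
    using assms dvd_freq_bounds[of d N] by (intro power_decreasing) auto
  also have "\<dots> \<le> (1 / real d)\<^sup>2"
    using assms dvd_freq_bounds[of d N] by (intro power_mono) auto
  finally show ?thesis by (simp add: power_divide)
qed

lemma prod_dvd_ind:
  assumes "finite I"
  shows "(\<Prod>i\<in>I. dvd_ind d (x i)) = of_bool (d dvd (GCD i\<in>I. x i))"
proof -
  have "(\<Prod>i\<in>I. dvd_ind d (x i)) = of_bool (\<forall>i\<in>I. d dvd x i)"
    using assms by (induction I rule: finite_induct) (auto simp: dvd_ind_def)
  then show ?thesis by (simp add: dvd_Gcd_iff)
qed

lemma Gcd_range:
  fixes x :: "'b \<Rightarrow> nat"
  assumes "i \<in> I" "x i \<in> {1..N}"
  shows "(GCD i\<in>I. x i) \<in> {1..N}"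
proof -
  have "(GCD i\<in>I. x i) dvd x i" using assms by (intro Gcd_dvd) auto
  moreover have "0 < x i" "x i \<le> N" using assms(2) by auto
  ultimately have "0 < (GCD i\<in>I. x i)" "(GCD i\<in>I. x i) \<le> N"
    using dvd_imp_le[of "GCD i\<in>I. x i" "x i"] by (auto intro: dvd_pos_nat)
  then show ?thesis by simp
qed

lemma gcd_kernel_eq_Gcd:
  assumes "finite I" "i \<in> I" "x i \<in> {1..N}"
  shows "gcd_kernel N I x = real (GCD i\<in>I. x i)"
proof -
  define g where "g = (GCD i\<in>I. x i)"
  have g: "g \<in> {1..N}" using Gcd_range[of i I x N] assms by (simp add: g_def)
  have "gcd_kernel N I x = (\<Sum>d = 1..N. if d dvd g then real (totient d) else 0)"
    unfolding gcd_kernel_def using assms by (intro sum.cong) (auto simp: prod_dvd_ind g_def)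
  also have "\<dots> = (\<Sum>d | d \<in> {1..N} \<and> d dvd g. real (totient d))"
    by (subst sum.inter_filter) auto
  also have "{d. d \<in> {1..N} \<and> d dvd g} = {d. d dvd g}"
    using g by (auto dest: dvd_imp_le intro: Nat.gr0I simp: Suc_le_eq)
  also have "(\<Sum>d | d dvd g. real (totient d)) = real (\<Sum>d | d dvd g. totient d)" by simp
  finally show ?thesis by (simp add: totient_divisor_sum g_def)
qed

text \<open>
  On the right, the term in which \<open>d\<close> is the gcd alone equals the left-hand side. Enlarging the
  event that the gcd is \<open>d\<close> to the event that it is divisible by \<open>d\<close> produces a product over
  \<open>I\<close>, which independence can handle.
\<close>
lemma Gcd_square_le:
  assumes "finite I" "i \<in> I" "x i \<in> {1..N}"
  shows "(real (GCD i\<in>I. x i))\<^sup>2 \<le> (\<Sum>d = 1..N. (real d)\<^sup>2 * (\<Prod>i\<in>I. dvd_ind d (x i)))"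
proof -
  define g where "g = (GCD i\<in>I. x i)"
  have g: "g \<in> {1..N}" using Gcd_range[of i I x N] assms by (simp add: g_def)
  have "(real g)\<^sup>2 = (real g)\<^sup>2 * (\<Prod>i\<in>I. dvd_ind g (x i))"
    using assms by (simp add: prod_dvd_ind g_def)
  also have "\<dots> \<le> (\<Sum>d = 1..N. (real d)\<^sup>2 * (\<Prod>i\<in>I. dvd_ind d (x i)))"
    using g by (intro member_le_sum) (auto intro!: mult_nonneg_nonneg prod_nonneg dvd_ind_bounds)
  finally show ?thesis by (simp add: g_def)
qed

lemma sum_inverse_le_sqrt: "(\<Sum>d = 1..N. 1 / real d) \<le> 2 * sqrt N"
proof (induction N)
  case (Suc N)
  define u v where "u = sqrt (real N)" and "v = sqrt (real (Suc N))"
  have uv: "0 \<le> u" "u \<le> v" "1 \<le> v" "v\<^sup>2 = u\<^sup>2 + 1" by (auto simp: u_def v_def)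
  have "1 = (v - u) * (v + u)" using uv(4) by (simp add: power2_eq_square algebra_simps)
  also have "\<dots> \<le> (v - u) * (2 * v)" using uv by (intro mult_left_mono) auto
  also have "\<dots> \<le> (v - u) * (2 * v\<^sup>2)"
    using uv(1-3) by (intro mult_left_mono) (auto simp: power2_eq_square mult_le_cancel_left1)
  finally have "1 / v\<^sup>2 \<le> 2 * v - 2 * u"
    using uv(3) by (subst pos_divide_le_eq) (auto simp: algebra_simps)
  moreover have "v\<^sup>2 = real (Suc N)" by (simp add: v_def)
  ultimately show ?case using Suc by (simp add: u_def v_def)
qed simp

text \<open>
  Since \<open>r - 1 \<ge> 2\<close>, the term of \<open>d\<close> is at most \<open>d / d\<^sup>2\<close>, which leaves a harmonic sum. The
  true order is at most \<open>ln N\<close>, but \<open>sqrt N\<close> is already small enough: with a variance of order at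
  least \<open>1/N\<close> it leads to the error \<open>N / sqrt m\<close>.
\<close>
lemma gcd_proj_bounds:
  assumes "r \<ge> 3"
  shows "0 \<le> gcd_proj N r x" "gcd_proj N r x \<le> 2 * sqrt N"
proof -
  show "0 \<le> gcd_proj N r x"
    unfolding gcd_proj_def
    by (intro sum_nonneg mult_nonneg_nonneg zero_le_power dvd_ind_bounds dvd_freq_bounds) auto
  have "gcd_proj N r x \<le> (\<Sum>d = 1..N. 1 / real d)"
    unfolding gcd_proj_def
  proof (rule sum_mono)
    fix d assume d: "d \<in> {1..N}"
    have "real (totient d) * dvd_freq N d ^ (r - 1) * dvd_ind d x \<le> real d * (1 / (real d)\<^sup>2) * 1"
      using d assms totient_le[of d]
      by (intro mult_mono dvd_freq_power_le mult_nonneg_nonneg zero_le_power dvd_ind_bounds dvd_freq_bounds)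
         auto
    then show "real (totient d) * dvd_freq N d ^ (r - 1) * dvd_ind d x \<le> 1 / real d"
      using d by (simp add: power2_eq_square)
  qed
  also have "\<dots> \<le> 2 * sqrt N" by (rule sum_inverse_le_sqrt)
  finally show "gcd_proj N r x \<le> 2 * sqrt N" .
qed

lemma avg_gcd_proj:
  assumes "r \<ge> 1"
  shows "avg N (gcd_proj N r) = gcd_mean N r"
proof -
  have "avg N (gcd_proj N r) = (\<Sum>d = 1..N. totient d * dvd_freq N d ^ (r - 1) * dvd_freq N d)"
    unfolding gcd_proj_def by (simp add: avg_sum avg_cmult)
  also have "\<dots> = gcd_mean N r"
    unfolding gcd_mean_def using assms
    by (intro sum.cong refl) (cases r, simp_all add: mult_ac)
  finally show ?thesis .
qed

lemma gcd_proj_deviation_le: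
  assumes "r \<ge> 3" "N \<ge> 1"
  shows "\<bar>gcd_proj N r x - gcd_mean N r\<bar> \<le> 2 * sqrt N"
proof -
  have "avg N (gcd_proj N r) \<le> avg N (\<lambda>_. 2 * sqrt N)"
    "avg N (\<lambda>_. 0) \<le> avg N (gcd_proj N r)"
    using gcd_proj_bounds[OF assms(1)] by (auto intro!: avg_mono)
  then have "0 \<le> gcd_mean N r" "gcd_mean N r \<le> 2 * sqrt N"
    using assms by (simp_all add: avg_const avg_gcd_proj)
  then show ?thesis using gcd_proj_bounds[OF assms(1), of N x] by linarith
qed

lemma gcd_proj_var_eq:
  assumes "r \<ge> 1" "N \<ge> 1"
  shows "gcd_proj_var N r = avg N (\<lambda>x. (gcd_proj N r x)\<^sup>2) - (gcd_mean N r)\<^sup>2"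
proof -
  define \<theta> where "\<theta> = gcd_mean N r"
  have "gcd_proj_var N r = avg N (\<lambda>x. (gcd_proj N r x)\<^sup>2 - (2 * \<theta>) * gcd_proj N r x + \<theta>\<^sup>2)"
    unfolding gcd_proj_var_def by (simp add: \<theta>_def power2_diff algebra_simps)
  also have "\<dots> = avg N (\<lambda>x. (gcd_proj N r x)\<^sup>2) - (2 * \<theta>) * \<theta> + \<theta>\<^sup>2"
    using assms by (simp only: avg_add avg_diff avg_cmult avg_const) (simp add: avg_gcd_proj \<theta>_def)
  finally show ?thesis by (simp add: \<theta>_def power2_eq_square)
qed

text \<open>
  Only the values 1 and 2 are used: passing from 1 to 2 adds the term of \<open>d = 2\<close>, and the frequency
  of even numbers in \<open>{1..N}\<close> is at least \<open>1/3\<close> (attained for \<open>N = 3\<close>). The factor \<open>1/N\<close> is the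
  probability of each value.
\<close>
lemma gcd_proj_var_ge:
  assumes "N \<ge> 2"
  shows "gcd_proj_var N r \<ge> (1 / 3) ^ (2 * (r - 1)) / 2 / N"
proof -
  define \<theta> where "\<theta> = gcd_mean N r"
  define a b where "a = gcd_proj N r 1 - \<theta>" and "b = gcd_proj N r 2 - \<theta>"
  have step: "gcd_proj N r 1 + (1 / 3) ^ (r - 1) \<le> gcd_proj N r 2"
  proof -
    have "totient 2 * dvd_freq N 2 ^ (r - 1) * (dvd_ind 2 2 - dvd_ind 2 1)
        \<le> (\<Sum>d = 1..N. totient d * dvd_freq N d ^ (r - 1) * (dvd_ind d 2 - dvd_ind d 1))"
      using assms
      by (intro member_le_sum mult_nonneg_nonneg zero_le_power dvd_freq_bounds) (auto simp: dvd_ind_def)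
    also have "\<dots> = gcd_proj N r 2 - gcd_proj N r 1"
      by (simp add: gcd_proj_def right_diff_distrib sum_subtractf)
    finally have "dvd_freq N 2 ^ (r - 1) \<le> gcd_proj N r 2 - gcd_proj N r 1"
      by (simp add: dvd_ind_def)
    moreover have "dvd_freq N 2 \<ge> 1 / 3"
    proof -
      have "N \<le> 3 * (N div 2)" using assms by presburger
      then have "real N \<le> 3 * real (N div 2)" by linarith
      then show ?thesis using assms by (simp add: dvd_freq_eq divide_simps)
    qed
    then have "dvd_freq N 2 ^ (r - 1) \<ge> (1 / 3) ^ (r - 1)" by (intro power_mono) auto
    ultimately show ?thesis by linarith
  qed
  have "((1 / 3) ^ (r - 1))\<^sup>2 \<le> (b - a)\<^sup>2"
    using step by (intro power_mono) (auto simp: a_def b_def)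
  also have "\<dots> \<le> 2 * (a\<^sup>2 + b\<^sup>2)"
    using sum_squares_bound[of a "-b"] by (simp add: power2_diff mult_ac)
  finally have *: "(1 / 3) ^ (2 * (r - 1)) / 2 \<le> a\<^sup>2 + b\<^sup>2"
    by (simp add: power_mult[symmetric] mult.commute)
  also have "\<dots> = (\<Sum>x\<in>{1, 2}. (gcd_proj N r x - \<theta>)\<^sup>2)" by (simp add: a_def b_def)
  also have "\<dots> \<le> (\<Sum>x = 1..N. (gcd_proj N r x - \<theta>)\<^sup>2)"
    using assms by (intro sum_mono2) auto
  finally show ?thesis
    unfolding gcd_proj_var_def avg_def \<theta>_def[symmetric] by (rule divide_right_mono) simp
qed

section \<open>Uniform sequences\<close>

text \<open>
  Boundedness is required everywhere, not just almost everywhere, so that this class of integrable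
  functions is trivially closed under the arithmetic operations.
\<close>
definition (in prob_space) bounded_rv :: "('a \<Rightarrow> real) \<Rightarrow> bool" where
  "bounded_rv f \<longleftrightarrow> random_variable borel f \<and> (\<exists>B. \<forall>\<omega>. \<bar>f \<omega>\<bar> \<le> B)"

context prob_space
begin

lemma bounded_rv_measurable: "bounded_rv f \<Longrightarrow> random_variable borel f"
  by (simp add: bounded_rv_def)

lemma bounded_rv_integrable: "bounded_rv f \<Longrightarrow> integrable M f"
  unfolding bounded_rv_def by (metis AE_I2 integrable_const_bound real_norm_def)

lemma bounded_rv_const: "bounded_rv (\<lambda>_. c)"
  by (auto simp: bounded_rv_def)

lemma bounded_rv_add:
  assumes "bounded_rv f" "bounded_rv g"
  shows "bounded_rv (\<lambda>\<omega>. f \<omega> + g \<omega>)"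
proof -
  obtain B C where "\<bar>f \<omega>\<bar> \<le> B" "\<bar>g \<omega>\<bar> \<le> C" for \<omega>
    using assms by (auto simp: bounded_rv_def)
  then have "\<bar>f \<omega> + g \<omega>\<bar> \<le> B + C" for \<omega>
    by (meson abs_triangle_ineq add_mono order_trans)
  then show ?thesis using assms by (auto simp: bounded_rv_def)
qed

lemma bounded_rv_mult:
  assumes "bounded_rv f" "bounded_rv g"
  shows "bounded_rv (\<lambda>\<omega>. f \<omega> * g \<omega>)"
proof -
  obtain B C where "\<bar>f \<omega>\<bar> \<le> B" "\<bar>g \<omega>\<bar> \<le> C" for \<omega>
    using assms by (auto simp: bounded_rv_def)
  then have "\<bar>f \<omega> * g \<omega>\<bar> \<le> B * C" for \<omega>
    unfolding abs_mult by (meson abs_ge_zero mult_mono order_trans)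
  then show ?thesis using assms by (auto simp: bounded_rv_def)
qed

lemma bounded_rv_diff:
  "bounded_rv f \<Longrightarrow> bounded_rv g \<Longrightarrow> bounded_rv (\<lambda>\<omega>. f \<omega> - g \<omega>)"
  using bounded_rv_add[of f "\<lambda>\<omega>. -1 * g \<omega>"] bounded_rv_mult[OF bounded_rv_const[of "-1"], of g]
  by simp

lemma bounded_rv_power2: "bounded_rv f \<Longrightarrow> bounded_rv (\<lambda>\<omega>. (f \<omega>)\<^sup>2)"
  by (simp add: power2_eq_square bounded_rv_mult)

lemma bounded_rv_sum:
  "(\<And>i. i \<in> A \<Longrightarrow> bounded_rv (f i)) \<Longrightarrow> bounded_rv (\<lambda>\<omega>. \<Sum>i\<in>A. f i \<omega>)"
  by (induction A rule: infinite_finite_induct) (auto intro: bounded_rv_const bounded_rv_add)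

lemma bounded_rv_prod:
  "(\<And>i. i \<in> A \<Longrightarrow> bounded_rv (f i)) \<Longrightarrow> bounded_rv (\<lambda>\<omega>. \<Prod>i\<in>A. f i \<omega>)"
  by (induction A rule: infinite_finite_induct) (auto intro: bounded_rv_const bounded_rv_mult)

lemmas bounded_rv_intros = bounded_rv_const bounded_rv_add bounded_rv_diff bounded_rv_mult
  bounded_rv_power2 bounded_rv_sum bounded_rv_prod

end

locale uniform_sequence = prob_space M for M :: "'a measure" +
  fixes X :: "nat \<Rightarrow> 'a \<Rightarrow> nat" and N :: nat
  assumes N_pos: "N \<ge> 1"
    and indep: "indep_vars (\<lambda>_. count_space UNIV) X {1..}"
    and distr_X: "\<And>i. i \<ge> 1 \<Longrightarrow> distr M (count_space UNIV) (X i) = measure_pmf (pmf_of_set {1..N})"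
begin

lemma X_measurable: "i \<ge> 1 \<Longrightarrow> X i \<in> measurable M (count_space UNIV)"
  using indep by (simp add: indep_vars_def2)

lemma comp_X_measurable: "i \<ge> 1 \<Longrightarrow> random_variable borel (\<lambda>\<omega>. f (X i \<omega>))" for f :: "nat \<Rightarrow> real"
  by (rule measurable_compose[OF X_measurable]) simp_all

lemma expectation_comp_X:
  fixes f :: "nat \<Rightarrow> real"
  assumes i: "i \<ge> 1"
  shows "expectation (\<lambda>\<omega>. f (X i \<omega>)) = avg N f" "integrable M (\<lambda>\<omega>. f (X i \<omega>))"
proof -
  have ne: "{1..N} \<noteq> {}" using N_pos by simp
  have "expectation (\<lambda>\<omega>. f (X i \<omega>)) = (\<integral>x. f x \<partial>distr M (count_space UNIV) (X i))"
    by (intro integral_distr[symmetric] X_measurable i) simp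
  also have "\<dots> = avg N f"
    unfolding distr_X[OF i] using ne by (subst integral_pmf_of_set) (simp_all add: avg_def)
  finally show "expectation (\<lambda>\<omega>. f (X i \<omega>)) = avg N f" .
  have "integrable (distr M (count_space UNIV) (X i)) f"
    unfolding distr_X[OF i] using ne by (intro integrable_measure_pmf_finite) simp
  then show "integrable M (\<lambda>\<omega>. f (X i \<omega>))"
    by (rule integrable_distr[OF X_measurable[OF i]])
qed

lemma AE_X_range:
  assumes i: "i \<ge> 1"
  shows "AE \<omega> in M. X i \<omega> \<in> {1..N}"
proof -
  have "AE x in distr M (count_space UNIV) (X i). x \<in> {1..N}"
    unfolding distr_X[OF i] using N_pos by (simp add: AE_measure_pmf_iff)
  then show ?thesis
    by (subst (asm) AE_distr_iff) (auto intro: X_measurable i)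
qed

lemma expectation_prod_X:
  fixes f :: "nat \<Rightarrow> nat \<Rightarrow> real"
  assumes S: "finite S" "S \<subseteq> {1..}"
  shows "expectation (\<lambda>\<omega>. \<Prod>i\<in>S. f i (X i \<omega>)) = (\<Prod>i\<in>S. avg N (f i))"
proof -
  have "indep_vars (\<lambda>_. borel) (\<lambda>i \<omega>. f i (X i \<omega>)) S"
    by (rule indep_vars_compose2[OF indep_vars_subset[OF indep S(2)]]) simp
  moreover have "integrable M (\<lambda>\<omega>. f i (X i \<omega>))" if "i \<in> S" for i
    using that S by (intro expectation_comp_X) auto
  ultimately have "expectation (\<lambda>\<omega>. \<Prod>i\<in>S. f i (X i \<omega>)) = (\<Prod>i\<in>S. expectation (\<lambda>\<omega>. f i (X i \<omega>)))"
    using S(1) by (intro indep_vars_lebesgue_integral)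
  also have "\<dots> = (\<Prod>i\<in>S. avg N (f i))"
    using S by (intro prod.cong refl expectation_comp_X) auto
  finally show ?thesis .
qed

lemma expectation_dvd_prod:
  assumes "finite I" "I \<subseteq> {1..}"
  shows "expectation (\<lambda>\<omega>. \<Prod>i\<in>I. dvd_ind d (X i \<omega>)) = dvd_freq N d ^ card I"
  using expectation_prod_X[OF assms, of "\<lambda>_. dvd_ind d"] by simp

text \<open>
  Every second moment below is a combination of these: by independence each index contributes a factor
  that depends only on which of the two sets it belongs to.
\<close>
lemma expectation_dvd_products:
  assumes I: "finite I" "I \<subseteq> {1..}" and J: "finite J" "J \<subseteq> {1..}"
  shows "expectation (\<lambda>\<omega>. (\<Prod>i\<in>I. dvd_ind d (X i \<omega>)) * (\<Prod>j\<in>J. dvd_ind e (X j \<omega>)))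
           = dvd_freq N d ^ card (I - J) * dvd_freq N e ^ card (J - I)
             * avg N (\<lambda>x. dvd_ind d x * dvd_ind e x) ^ card (I \<inter> J)"
proof -
  define f where "f i x = (if i \<in> I then dvd_ind d x else 1) * (if i \<in> J then dvd_ind e x else 1)"
    for i :: nat and x
  have "(\<Prod>i\<in>I. dvd_ind d (X i \<omega>)) * (\<Prod>j\<in>J. dvd_ind e (X j \<omega>)) = (\<Prod>i\<in>I \<union> J. f i (X i \<omega>))" for \<omega>
  proof -
    have "(\<Prod>i\<in>I. dvd_ind d (X i \<omega>)) = (\<Prod>i\<in>I \<union> J. if i \<in> I then dvd_ind d (X i \<omega>) else 1)"
      using I J by (subst prod.inter_restrict[symmetric]) (auto intro: prod.cong)
    moreover have "(\<Prod>i\<in>J. dvd_ind e (X i \<omega>)) = (\<Prod>i\<in>I \<union> J. if i \<in> J then dvd_ind e (X i \<omega>) else 1)"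
      using I J by (subst prod.inter_restrict[symmetric]) (auto intro: prod.cong)
    ultimately show ?thesis by (simp add: f_def prod.distrib)
  qed
  then have "expectation (\<lambda>\<omega>. (\<Prod>i\<in>I. dvd_ind d (X i \<omega>)) * (\<Prod>j\<in>J. dvd_ind e (X j \<omega>)))
      = (\<Prod>i\<in>I \<union> J. avg N (f i))"
    using I J by (simp only: expectation_prod_X finite_Un Un_subset_iff)
  also have "I \<union> J = (I - J) \<union> ((J - I) \<union> (I \<inter> J))" by auto
  also have "(\<Prod>i\<in>(I - J) \<union> ((J - I) \<union> (I \<inter> J)). avg N (f i))
     = (\<Prod>i\<in>I - J. avg N (f i)) * ((\<Prod>i\<in>J - I. avg N (f i)) * (\<Prod>i\<in>I \<inter> J. avg N (f i)))"
  proof -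
    have "(\<Prod>i\<in>(J - I) \<union> (I \<inter> J). avg N (f i)) = (\<Prod>i\<in>J - I. avg N (f i)) * (\<Prod>i\<in>I \<inter> J. avg N (f i))"
      using I J by (intro prod.union_disjoint) auto
    then show ?thesis
      using I J by (subst prod.union_disjoint) auto
  qed
  also have "(\<Prod>i\<in>I - J. avg N (f i)) = (\<Prod>i\<in>I - J. dvd_freq N d)"
    by (intro prod.cong refl) (auto simp: f_def[abs_def])
  also have "(\<Prod>i\<in>J - I. avg N (f i)) = (\<Prod>i\<in>J - I. dvd_freq N e)"
    by (intro prod.cong refl) (auto simp: f_def[abs_def])
  also have "(\<Prod>i\<in>I \<inter> J. avg N (f i)) = (\<Prod>i\<in>I \<inter> J. avg N (\<lambda>x. dvd_ind d x * dvd_ind e x))"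
    by (intro prod.cong refl) (auto simp: f_def[abs_def])
  finally show ?thesis by (simp add: mult.assoc)
qed

lemma bounded_rv_comp_X:
  assumes "i \<ge> 1" "\<And>x. \<bar>f x\<bar> \<le> B"
  shows "bounded_rv (\<lambda>\<omega>. f (X i \<omega>))"
  using assms comp_X_measurable[of i f] by (auto simp: bounded_rv_def)

lemma bounded_rv_dvd_prod:
  assumes "I \<subseteq> {1..}"
  shows "bounded_rv (\<lambda>\<omega>. \<Prod>i\<in>I. dvd_ind d (X i \<omega>))"
  using assms
  by (intro bounded_rv_prod bounded_rv_comp_X[where B = 1]) (auto simp: dvd_ind_def)

lemma bounded_rv_gcd_kernel:
  assumes "I \<subseteq> {1..}"
  shows "bounded_rv (\<lambda>\<omega>. gcd_kernel N I (\<lambda>i. X i \<omega>))"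
  unfolding gcd_kernel_def using assms by (intro bounded_rv_intros bounded_rv_dvd_prod)

lemma bounded_rv_gcd_proj:
  assumes "r \<ge> 3" "i \<ge> 1"
  shows "bounded_rv (\<lambda>\<omega>. gcd_proj N r (X i \<omega>))"
  using gcd_proj_bounds[OF assms(1), of N] assms
  by (intro bounded_rv_comp_X[where B = "2 * sqrt N"]) (auto simp: abs_le_iff intro: order_trans)

lemma expectation_sum_bounded:
  "(\<And>i. i \<in> A \<Longrightarrow> bounded_rv (f i)) \<Longrightarrow> expectation (\<lambda>\<omega>. \<Sum>i\<in>A. f i \<omega>) = (\<Sum>i\<in>A. expectation (f i))"
  by (rule Bochner_Integration.integral_sum) (rule bounded_rv_integrable)

lemma expectation_double_sum_bounded:
  assumes "\<And>i j. i \<in> A \<Longrightarrow> j \<in> B \<Longrightarrow> bounded_rv (f i j)"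
  shows "expectation (\<lambda>\<omega>. \<Sum>i\<in>A. \<Sum>j\<in>B. f i j \<omega>) = (\<Sum>i\<in>A. \<Sum>j\<in>B. expectation (f i j))"
proof -
  have "expectation (\<lambda>\<omega>. \<Sum>i\<in>A. \<Sum>j\<in>B. f i j \<omega>) = (\<Sum>i\<in>A. expectation (\<lambda>\<omega>. \<Sum>j\<in>B. f i j \<omega>))"
    by (rule expectation_sum_bounded) (intro bounded_rv_sum assms)
  also have "\<dots> = (\<Sum>i\<in>A. \<Sum>j\<in>B. expectation (f i j))"
    by (intro sum.cong refl expectation_sum_bounded assms)
  finally show ?thesis .
qed

lemma expectation_gcd_kernel:
  assumes "finite I" "I \<subseteq> {1..}"
  shows "expectation (\<lambda>\<omega>. gcd_kernel N I (\<lambda>i. X i \<omega>)) = gcd_mean N (card I)"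
proof -
  have "expectation (\<lambda>\<omega>. gcd_kernel N I (\<lambda>i. X i \<omega>))
      = (\<Sum>d = 1..N. totient d * expectation (\<lambda>\<omega>. \<Prod>i\<in>I. dvd_ind d (X i \<omega>)))"
    unfolding gcd_kernel_def using assms
    by (subst expectation_sum_bounded) (auto intro!: bounded_rv_intros bounded_rv_dvd_prod)
  then show ?thesis
    using assms by (simp add: expectation_dvd_prod gcd_mean_def)
qed

lemma expectation_gcd_kernel_product:
  assumes I: "finite I" "I \<subseteq> {1..}" "card I = r" and J: "finite J" "J \<subseteq> {1..}" "card J = r"
  shows "expectation (\<lambda>\<omega>. gcd_kernel N I (\<lambda>i. X i \<omega>) * gcd_kernel N J (\<lambda>i. X i \<omega>))
    = (\<Sum>d = 1..N. \<Sum>e = 1..N. totient d * totient e *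
        (dvd_freq N d ^ (r - card (I \<inter> J)) * dvd_freq N e ^ (r - card (I \<inter> J))
          * avg N (\<lambda>x. dvd_ind d x * dvd_ind e x) ^ card (I \<inter> J)))"
proof -
  have card: "card (I - J) = r - card (I \<inter> J)" "card (J - I) = r - card (I \<inter> J)"
    using I J by (simp_all add: card_Diff_subset_Int Int_commute)
  have "expectation (\<lambda>\<omega>. gcd_kernel N I (\<lambda>i. X i \<omega>) * gcd_kernel N J (\<lambda>i. X i \<omega>))
    = expectation (\<lambda>\<omega>. \<Sum>d = 1..N. \<Sum>e = 1..N. (totient d * totient e) *
        ((\<Prod>i\<in>I. dvd_ind d (X i \<omega>)) * (\<Prod>j\<in>J. dvd_ind e (X j \<omega>))))"
    by (simp add: gcd_kernel_def sum_product mult_ac)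
  also have "\<dots> = (\<Sum>d = 1..N. \<Sum>e = 1..N. expectation (\<lambda>\<omega>. (totient d * totient e) *
        ((\<Prod>i\<in>I. dvd_ind d (X i \<omega>)) * (\<Prod>j\<in>J. dvd_ind e (X j \<omega>)))))"
    using I J
    by (intro expectation_double_sum_bounded bounded_rv_intros bounded_rv_dvd_prod) auto
  also have "\<dots> = (\<Sum>d = 1..N. \<Sum>e = 1..N. totient d * totient e *
        (dvd_freq N d ^ (r - card (I \<inter> J)) * dvd_freq N e ^ (r - card (I \<inter> J))
          * avg N (\<lambda>x. dvd_ind d x * dvd_ind e x) ^ card (I \<inter> J)))"
    using expectation_dvd_products[OF I(1,2) J(1,2)] by (simp add: card)
  finally show ?thesis .
qed

lemma avg_gcd_proj_square:
  "avg N (\<lambda>x. (gcd_proj N r x)\<^sup>2) = (\<Sum>d = 1..N. \<Sum>e = 1..N. totient d * totient e *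
        (dvd_freq N d ^ (r - 1) * dvd_freq N e ^ (r - 1)
          * avg N (\<lambda>x. dvd_ind d x * dvd_ind e x)))"
proof -
  have "(gcd_proj N r x)\<^sup>2 = (\<Sum>d = 1..N. \<Sum>e = 1..N. (totient d * totient e *
        (dvd_freq N d ^ (r - 1) * dvd_freq N e ^ (r - 1))) * (dvd_ind d x * dvd_ind e x))" for x
    by (simp add: gcd_proj_def power2_eq_square sum_product mult_ac)
  then show ?thesis
    by (simp only: avg_sum avg_cmult) (simp add: mult.assoc)
qed

lemma expectation_gcd_kernel_gcd_proj:
  assumes I: "finite I" "I \<subseteq> {1..}" "card I = r" "r \<ge> 1" and i: "i \<ge> 1"
  shows "expectation (\<lambda>\<omega>. gcd_kernel N I (\<lambda>i. X i \<omega>) * gcd_proj N r (X i \<omega>))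
    = (if i \<in> I then avg N (\<lambda>x. (gcd_proj N r x)\<^sup>2) else (gcd_mean N r)\<^sup>2)"
proof -
  have "expectation (\<lambda>\<omega>. gcd_kernel N I (\<lambda>i. X i \<omega>) * gcd_proj N r (X i \<omega>))
    = expectation (\<lambda>\<omega>. \<Sum>d = 1..N. \<Sum>e = 1..N. (totient d * totient e * dvd_freq N e ^ (r - 1)) *
        ((\<Prod>i\<in>I. dvd_ind d (X i \<omega>)) * (\<Prod>j\<in>{i}. dvd_ind e (X j \<omega>))))"
    by (simp add: gcd_kernel_def gcd_proj_def sum_product mult_ac)
  also have "\<dots> = (\<Sum>d = 1..N. \<Sum>e = 1..N. expectation (\<lambda>\<omega>. (totient d * totient e * dvd_freq N e ^ (r - 1)) *
        ((\<Prod>i\<in>I. dvd_ind d (X i \<omega>)) * (\<Prod>j\<in>{i}. dvd_ind e (X j \<omega>)))))"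
    using I i
    by (intro expectation_double_sum_bounded bounded_rv_intros bounded_rv_dvd_prod) auto
  also have "\<dots> = (\<Sum>d = 1..N. \<Sum>e = 1..N. totient d * totient e * dvd_freq N e ^ (r - 1) *
        (dvd_freq N d ^ card (I - {i}) * dvd_freq N e ^ card ({i} - I)
             * avg N (\<lambda>x. dvd_ind d x * dvd_ind e x) ^ card (I \<inter> {i})))"
    using expectation_dvd_products[OF I(1,2), of "{i}"] i by simp
  also have "\<dots> = (if i \<in> I then avg N (\<lambda>x. (gcd_proj N r x)\<^sup>2) else (gcd_mean N r)\<^sup>2)"
  proof (cases "i \<in> I")
    case True
    then have "card (I - {i}) = r - 1" "{i} - I = {}" "I \<inter> {i} = {i}" using I by auto
    with True show ?thesis by (simp add: avg_gcd_proj_square mult_ac)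
  next
    case False
    then have eq: "I - {i} = I" "{i} - I = {i}" "I \<inter> {i} = {}" by auto
    obtain k where k: "r = Suc k" using I(4) by (cases r) auto
    show ?thesis
      using False I(3) by (simp add: eq k gcd_mean_def power2_eq_square sum_product mult_ac)
  qed
  finally show ?thesis .
qed

lemma expectation_gcd_kernel_square_le:
  assumes I: "finite I" "I \<subseteq> {1..}" "card I \<ge> 2"
  shows "expectation (\<lambda>\<omega>. (gcd_kernel N I (\<lambda>i. X i \<omega>))\<^sup>2) \<le> N"
proof -
  obtain i where i: "i \<in> I" using I by (cases "I = {}") auto
  have "expectation (\<lambda>\<omega>. (gcd_kernel N I (\<lambda>i. X i \<omega>))\<^sup>2)
      \<le> expectation (\<lambda>\<omega>. \<Sum>d = 1..N. (real d)\<^sup>2 * (\<Prod>i\<in>I. dvd_ind d (X i \<omega>)))"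
  proof (rule integral_mono_AE)
    show "AE \<omega> in M. (gcd_kernel N I (\<lambda>i. X i \<omega>))\<^sup>2 \<le> (\<Sum>d = 1..N. (real d)\<^sup>2 * (\<Prod>i\<in>I. dvd_ind d (X i \<omega>)))"
    proof (rule AE_mp[OF AE_X_range[of i] AE_I2], goal_cases)
      case 1 then show ?case using i I by auto
    next
      case 2
      then show ?case
        using Gcd_square_le[OF I(1) i] gcd_kernel_eq_Gcd[OF I(1) i] by auto
    qed
  qed (use I in \<open>auto intro!: bounded_rv_integrable bounded_rv_intros bounded_rv_dvd_prod bounded_rv_gcd_kernel\<close>)
  also have "\<dots> = (\<Sum>d = 1..N. (real d)\<^sup>2 * dvd_freq N d ^ card I)"
    using I by (subst expectation_sum_bounded)
      (auto intro!: bounded_rv_intros bounded_rv_dvd_prod simp: expectation_dvd_prod)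
  also have "\<dots> \<le> (\<Sum>d = 1..N. (real d)\<^sup>2 * (1 / (real d)\<^sup>2))"
    using I by (intro sum_mono mult_left_mono dvd_freq_power_le) auto
  also have "\<dots> = (\<Sum>d = 1..N. 1)" by (intro sum.cong) auto
  finally show ?thesis by simp
qed

section \<open>Covariances and the linear part\<close>

lemma covariance_eq:
  assumes "bounded_rv f" "bounded_rv g"
    and "expectation f = a" "expectation g = b"
  shows "expectation (\<lambda>\<omega>. (f \<omega> - a) * (g \<omega> - b)) = expectation (\<lambda>\<omega>. f \<omega> * g \<omega>) - a * b"
proof -
  have "expectation (\<lambda>\<omega>. (f \<omega> - a) * (g \<omega> - b)) = expectation (\<lambda>\<omega>. f \<omega> * g \<omega> - b * f \<omega> - a * g \<omega> + a * b)"
    by (simp add: algebra_simps)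
  also have "\<dots> = expectation (\<lambda>\<omega>. f \<omega> * g \<omega>) - b * a - a * b + a * b"
    using assms bounded_rv_integrable[OF assms(1)] bounded_rv_integrable[OF assms(2)]
      bounded_rv_integrable[OF bounded_rv_mult[OF assms(1,2)]]
    by (simp add: prob_space)
  finally show ?thesis by simp
qed

lemma gcd_proj_var_nonneg: "0 \<le> gcd_proj_var N r"
  by (simp add: gcd_proj_var_def avg_def sum_nonneg)

text \<open>
  With \<open>k\<close> common indices the covariance is \<open>0\<close> for \<open>k = 0\<close>, the projection variance for \<open>k = 1\<close>,
  and by Cauchy-Schwarz at most \<open>N\<close> for \<open>k \<ge> 2\<close>. The three cases are merged into
  one bound in \<open>k\<close> and \<open>k (k - 1)\<close>, whose sums over pairs of sets are known in closed form.
\<close>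
lemma covariance_gcd_kernel_le:
  assumes I: "finite I" "I \<subseteq> {1..}" "card I = r" and J: "finite J" "J \<subseteq> {1..}" "card J = r"
    and r: "r \<ge> 2"
  shows "expectation (\<lambda>\<omega>. (gcd_kernel N I (\<lambda>i. X i \<omega>) - gcd_mean N r) * (gcd_kernel N J (\<lambda>i. X i \<omega>) - gcd_mean N r))
    \<le> gcd_proj_var N r * card (I \<inter> J) + N * (real (card (I \<inter> J)) * (real (card (I \<inter> J)) - 1))"
    (is "?C \<le> _")
proof -
  note bdd = bounded_rv_gcd_kernel[OF I(2)] bounded_rv_gcd_kernel[OF J(2)]
  have mean: "expectation (\<lambda>\<omega>. gcd_kernel N I (\<lambda>i. X i \<omega>)) = gcd_mean N r"
    "expectation (\<lambda>\<omega>. gcd_kernel N J (\<lambda>i. X i \<omega>)) = gcd_mean N r"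
    using expectation_gcd_kernel[OF I(1,2)] expectation_gcd_kernel[OF J(1,2)] I J by simp_all
  have C: "?C = expectation (\<lambda>\<omega>. gcd_kernel N I (\<lambda>i. X i \<omega>) * gcd_kernel N J (\<lambda>i. X i \<omega>)) - gcd_mean N r * gcd_mean N r"
    by (rule covariance_eq[OF bdd mean])
  consider "card (I \<inter> J) = 0" | "card (I \<inter> J) = 1" | "card (I \<inter> J) \<ge> 2" by linarith
  then show ?thesis
  proof cases
    case 1
    then have "?C = 0"
      unfolding C expectation_gcd_kernel_product[OF I J]
      by (simp add: gcd_mean_def sum_product mult_ac)
    then show ?thesis using 1 by simp
  next
    case 2
    then have "?C = gcd_proj_var N r"
      unfolding C expectation_gcd_kernel_product[OF I J]
      using r N_pos by (simp add: gcd_proj_var_eq avg_gcd_proj_square power2_eq_square[of "gcd_mean N r"])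
    then show ?thesis using 2 by simp
  next
    case 3
    have sq: "expectation (\<lambda>\<omega>. (gcd_kernel N K (\<lambda>i. X i \<omega>) - gcd_mean N r)\<^sup>2) \<le> N"
      if K: "finite K" "K \<subseteq> {1..}" "card K = r" for K
    proof -
      have "expectation (\<lambda>\<omega>. (gcd_kernel N K (\<lambda>i. X i \<omega>) - gcd_mean N r)\<^sup>2)
          = expectation (\<lambda>\<omega>. (gcd_kernel N K (\<lambda>i. X i \<omega>))\<^sup>2) - gcd_mean N r * gcd_mean N r"
        unfolding power2_eq_square
        using expectation_gcd_kernel[OF K(1,2)] K(3)
        by (intro covariance_eq bounded_rv_gcd_kernel K) auto
      moreover have "expectation (\<lambda>\<omega>. (gcd_kernel N K (\<lambda>i. X i \<omega>))\<^sup>2) \<le> N"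
        using K r by (intro expectation_gcd_kernel_square_le) auto
      ultimately show ?thesis
        using zero_le_square[of "gcd_mean N r"] by linarith
    qed
    have half: "x * y \<le> (x\<^sup>2 + y\<^sup>2) * (1 / 2)" for x y :: real
      using sum_squares_bound[of x y] by (simp add: mult_ac)
    have "?C \<le> expectation (\<lambda>\<omega>. ((gcd_kernel N I (\<lambda>i. X i \<omega>) - gcd_mean N r)\<^sup>2
        + (gcd_kernel N J (\<lambda>i. X i \<omega>) - gcd_mean N r)\<^sup>2) * (1 / 2))"
    proof (rule integral_mono)
      fix \<omega>
      show "(gcd_kernel N I (\<lambda>i. X i \<omega>) - gcd_mean N r) * (gcd_kernel N J (\<lambda>i. X i \<omega>) - gcd_mean N r)
        \<le> ((gcd_kernel N I (\<lambda>i. X i \<omega>) - gcd_mean N r)\<^sup>2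
        + (gcd_kernel N J (\<lambda>i. X i \<omega>) - gcd_mean N r)\<^sup>2) * (1 / 2)"
        by (rule half)
    qed (intro bounded_rv_integrable bounded_rv_intros bdd)+
    also have "\<dots> = (expectation (\<lambda>\<omega>. (gcd_kernel N I (\<lambda>i. X i \<omega>) - gcd_mean N r)\<^sup>2)
        + expectation (\<lambda>\<omega>. (gcd_kernel N J (\<lambda>i. X i \<omega>) - gcd_mean N r)\<^sup>2)) * (1 / 2)"
      unfolding integral_mult_left_zero
      by (subst Bochner_Integration.integral_add) (intro refl bounded_rv_integrable bounded_rv_intros bdd)+
    also have "\<dots> \<le> N" using sq[OF I] sq[OF J] by simp
    also have "real N \<le> N * (real (card (I \<inter> J)) * (real (card (I \<inter> J)) - 1))"
    proof -
      have "1 * 1 \<le> real (card (I \<inter> J)) * (real (card (I \<inter> J)) - 1)"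
        using 3 by (intro mult_mono) auto
      then show ?thesis by (simp add: mult_le_cancel_left1)
    qed
    also have "\<dots> \<le> gcd_proj_var N r * card (I \<inter> J) + N * (real (card (I \<inter> J)) * (real (card (I \<inter> J)) - 1))"
      using gcd_proj_var_nonneg[of r] by simp
    finally show ?thesis .
  qed
qed

lemma expectation_gcd_proj:
  assumes "r \<ge> 1" "i \<ge> 1"
  shows "expectation (\<lambda>\<omega>. gcd_proj N r (X i \<omega>)) = gcd_mean N r"
  using assms by (simp add: expectation_comp_X avg_gcd_proj)

lemma covariance_gcd_kernel_gcd_proj:
  assumes I: "finite I" "I \<subseteq> {1..}" "card I = r" and r: "r \<ge> 3" and i: "i \<ge> 1"
  shows "expectation (\<lambda>\<omega>. (gcd_kernel N I (\<lambda>i. X i \<omega>) - gcd_mean N r) * (gcd_proj N r (X i \<omega>) - gcd_mean N r))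
    = gcd_proj_var N r * of_bool (i \<in> I)"
proof -
  have "expectation (\<lambda>\<omega>. (gcd_kernel N I (\<lambda>i. X i \<omega>) - gcd_mean N r) * (gcd_proj N r (X i \<omega>) - gcd_mean N r))
     = expectation (\<lambda>\<omega>. gcd_kernel N I (\<lambda>i. X i \<omega>) * gcd_proj N r (X i \<omega>)) - gcd_mean N r * gcd_mean N r"
    using I r i expectation_gcd_kernel[OF I(1,2)]
    by (intro covariance_eq bounded_rv_gcd_kernel bounded_rv_gcd_proj expectation_gcd_proj) auto
  then show ?thesis
    using I r i N_pos
    by (simp add: expectation_gcd_kernel_gcd_proj gcd_proj_var_eq power2_eq_square)
qed

lemma covariance_gcd_proj:
  assumes r: "r \<ge> 3" and i: "i \<ge> 1" and j: "j \<ge> 1"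
  shows "expectation (\<lambda>\<omega>. (gcd_proj N r (X i \<omega>) - gcd_mean N r) * (gcd_proj N r (X j \<omega>) - gcd_mean N r))
    = gcd_proj_var N r * of_bool (i = j)"
proof (cases "i = j")
  case True
  then show ?thesis
    using expectation_comp_X(1)[OF j, of "\<lambda>x. (gcd_proj N r x - gcd_mean N r)\<^sup>2"]
    by (simp add: gcd_proj_var_def power2_eq_square)
next
  case False
  then have "expectation (\<lambda>\<omega>. (gcd_proj N r (X i \<omega>) - gcd_mean N r) * (gcd_proj N r (X j \<omega>) - gcd_mean N r))
     = avg N (\<lambda>x. gcd_proj N r x - gcd_mean N r) * avg N (\<lambda>x. gcd_proj N r x - gcd_mean N r)"
    using expectation_prod_X[of "{i, j}" "\<lambda>_ x. gcd_proj N r x - gcd_mean N r"] i j by simp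
  also have "\<dots> = 0"
    using r N_pos by (simp add: avg_diff avg_const avg_gcd_proj)
  finally show ?thesis using False by simp
qed

definition centered_gcd_sum :: "nat \<Rightarrow> nat \<Rightarrow> 'a \<Rightarrow> real" where
  "centered_gcd_sum m r \<omega> = (\<Sum>I | I \<subseteq> {1..m} \<and> card I = r. gcd_kernel N I (\<lambda>i. X i \<omega>) - gcd_mean N r)"

definition linear_part :: "nat \<Rightarrow> nat \<Rightarrow> 'a \<Rightarrow> real" where
  "linear_part m r \<omega> = real ((m - 1) choose (r - 1)) * (\<Sum>i = 1..m. gcd_proj N r (X i \<omega>) - gcd_mean N r)"

lemma bounded_rv_centered_gcd_sum: "bounded_rv (centered_gcd_sum m r)"
  unfolding centered_gcd_sum_def by (intro bounded_rv_intros bounded_rv_gcd_kernel) auto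

lemma bounded_rv_linear_part: "r \<ge> 3 \<Longrightarrow> bounded_rv (linear_part m r)"
  unfolding linear_part_def by (intro bounded_rv_intros bounded_rv_gcd_proj) auto

lemma expectation_linear_part_square:
  assumes r: "r \<ge> 3"
  shows "expectation (\<lambda>\<omega>. (linear_part m r \<omega>)\<^sup>2)
           = m * (real ((m - 1) choose (r - 1)))\<^sup>2 * gcd_proj_var N r"
proof -
  define c where "c = real ((m - 1) choose (r - 1))"
  define h where "h i \<omega> = gcd_proj N r (X i \<omega>) - gcd_mean N r" for i \<omega>
  have h: "bounded_rv (h i)" if "i \<in> {1..m}" for i
    unfolding h_def using that r by (intro bounded_rv_intros bounded_rv_gcd_proj) auto
  have "(\<lambda>\<omega>. (linear_part m r \<omega>)\<^sup>2) = (\<lambda>\<omega>. c\<^sup>2 * (\<Sum>i = 1..m. \<Sum>j = 1..m. h i \<omega> * h j \<omega>))"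
    by (simp add: linear_part_def c_def h_def power2_eq_square sum_product mult_ac)
  then have "expectation (\<lambda>\<omega>. (linear_part m r \<omega>)\<^sup>2)
      = c\<^sup>2 * expectation (\<lambda>\<omega>. \<Sum>i = 1..m. \<Sum>j = 1..m. h i \<omega> * h j \<omega>)"
    by simp
  also have "expectation (\<lambda>\<omega>. \<Sum>i = 1..m. \<Sum>j = 1..m. h i \<omega> * h j \<omega>)
      = (\<Sum>i = 1..m. \<Sum>j = 1..m. expectation (\<lambda>\<omega>. h i \<omega> * h j \<omega>))"
    by (intro expectation_double_sum_bounded bounded_rv_mult h)
  also have "\<dots> = (\<Sum>i = 1..m. \<Sum>j = 1..m. gcd_proj_var N r * of_bool (i = j))"
    unfolding h_def using r by (intro sum.cong refl covariance_gcd_proj) auto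
  also have "\<dots> = (\<Sum>i = 1..m. gcd_proj_var N r)"
    by (intro sum.cong refl) (simp add: sum_distrib_left[symmetric] of_bool_def)
  finally show ?thesis by (simp add: c_def)
qed

text \<open>
  The orthogonality relation behind the Hoeffding decomposition: a gcd correlates with
  \<open>h(X_i)\<close> only if \<open>i\<close> is one of its indices, and then with covariance equal to the variance of
  \<open>h(X_i)\<close>.
\<close>
lemma expectation_centered_gcd_sum_linear_part:
  assumes r: "r \<ge> 3"
  shows "expectation (\<lambda>\<omega>. centered_gcd_sum m r \<omega> * linear_part m r \<omega>)
           = expectation (\<lambda>\<omega>. (linear_part m r \<omega>)\<^sup>2)"
proof -
  define c where "c = real ((m - 1) choose (r - 1))"
  define \<I> where "\<I> = {I. I \<subseteq> {1..m} \<and> card I = r}"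
  define h where "h i \<omega> = gcd_proj N r (X i \<omega>) - gcd_mean N r" for i \<omega>
  define k where "k I \<omega> = gcd_kernel N I (\<lambda>i. X i \<omega>) - gcd_mean N r" for I \<omega>
  have h: "bounded_rv (h i)" if "i \<in> {1..m}" for i
    unfolding h_def using that r by (intro bounded_rv_intros bounded_rv_gcd_proj) auto
  have k: "bounded_rv (k I)" if "I \<in> \<I>" for I
    unfolding k_def using that by (intro bounded_rv_intros bounded_rv_gcd_kernel) (auto simp: \<I>_def)
  have "(\<lambda>\<omega>. centered_gcd_sum m r \<omega> * linear_part m r \<omega>)
      = (\<lambda>\<omega>. c * (\<Sum>i = 1..m. \<Sum>I\<in>\<I>. k I \<omega> * h i \<omega>))"
  proof
    fix \<omega>
    have "linear_part m r \<omega> = c * (\<Sum>i = 1..m. h i \<omega>)" "centered_gcd_sum m r \<omega> = (\<Sum>I\<in>\<I>. k I \<omega>)"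
      by (simp_all add: linear_part_def centered_gcd_sum_def c_def h_def k_def \<I>_def)
    moreover have "(\<Sum>i = 1..m. \<Sum>I\<in>\<I>. k I \<omega> * h i \<omega>) = (\<Sum>i = 1..m. h i \<omega>) * (\<Sum>I\<in>\<I>. k I \<omega>)"
      by (simp only: mult.commute[of "k _ _"] sum_product)
    ultimately show "centered_gcd_sum m r \<omega> * linear_part m r \<omega> = c * (\<Sum>i = 1..m. \<Sum>I\<in>\<I>. k I \<omega> * h i \<omega>)"
      by simp
  qed
  then have "expectation (\<lambda>\<omega>. centered_gcd_sum m r \<omega> * linear_part m r \<omega>)
      = c * expectation (\<lambda>\<omega>. \<Sum>i = 1..m. \<Sum>I\<in>\<I>. k I \<omega> * h i \<omega>)"
    by simp
  also have "expectation (\<lambda>\<omega>. \<Sum>i = 1..m. \<Sum>I\<in>\<I>. k I \<omega> * h i \<omega>)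
      = (\<Sum>i = 1..m. \<Sum>I\<in>\<I>. expectation (\<lambda>\<omega>. k I \<omega> * h i \<omega>))"
    by (intro expectation_double_sum_bounded bounded_rv_mult h k)
  also have "\<dots> = (\<Sum>i = 1..m. \<Sum>I\<in>\<I>. gcd_proj_var N r * of_bool ({i} \<subseteq> I))"
    unfolding h_def k_def using r
    by (intro sum.cong refl, subst covariance_gcd_kernel_gcd_proj)
       (auto simp: \<I>_def intro: finite_subset)
  also have "\<dots> = (\<Sum>i = 1..m. gcd_proj_var N r * c)"
  proof (intro sum.cong refl)
    fix i assume "i \<in> {1..m}"
    then have "(\<Sum>I\<in>\<I>. of_bool ({i} \<subseteq> I)) = c"
      unfolding \<I>_def c_def using r by (subst sum_subsets_indicator) auto
    then show "(\<Sum>I\<in>\<I>. gcd_proj_var N r * of_bool ({i} \<subseteq> I)) = gcd_proj_var N r * c"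
      by (simp only: sum_distrib_left[symmetric])
  qed
  finally show ?thesis
    using expectation_linear_part_square[OF r] by (simp add: c_def power2_eq_square)
qed

lemma expectation_centered_gcd_sum_square_le:
  assumes r: "r \<ge> 3"
  shows "expectation (\<lambda>\<omega>. (centered_gcd_sum m r \<omega>)\<^sup>2)
           \<le> expectation (\<lambda>\<omega>. (linear_part m r \<omega>)\<^sup>2)
             + N * (m * real (m - 1) * (real ((m - 2) choose (r - 2)))\<^sup>2)"
proof -
  define \<I> where "\<I> = {I. I \<subseteq> {1..m} \<and> card I = r}"
  define k where "k I \<omega> = gcd_kernel N I (\<lambda>i. X i \<omega>) - gcd_mean N r" for I \<omega>
  define n where "n I J = real (card (I \<inter> J))" for I J :: "nat set"
  have k: "bounded_rv (k I)" if "I \<in> \<I>" for I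
    unfolding k_def using that by (intro bounded_rv_intros bounded_rv_gcd_kernel) (auto simp: \<I>_def)
  have "(\<lambda>\<omega>. (centered_gcd_sum m r \<omega>)\<^sup>2) = (\<lambda>\<omega>. \<Sum>I\<in>\<I>. \<Sum>J\<in>\<I>. k I \<omega> * k J \<omega>)"
    by (simp add: centered_gcd_sum_def k_def \<I>_def power2_eq_square sum_product)
  then have "expectation (\<lambda>\<omega>. (centered_gcd_sum m r \<omega>)\<^sup>2) = (\<Sum>I\<in>\<I>. \<Sum>J\<in>\<I>. expectation (\<lambda>\<omega>. k I \<omega> * k J \<omega>))"
    by (simp only: expectation_double_sum_bounded bounded_rv_mult k)
  also have "\<dots> \<le> (\<Sum>I\<in>\<I>. \<Sum>J\<in>\<I>. gcd_proj_var N r * n I J + N * (n I J * (n I J - 1)))"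
    unfolding k_def n_def using r
    by (intro sum_mono covariance_gcd_kernel_le) (auto simp: \<I>_def intro: finite_subset)
  also have "\<dots> = gcd_proj_var N r * (\<Sum>I\<in>\<I>. \<Sum>J\<in>\<I>. n I J) + N * (\<Sum>I\<in>\<I>. \<Sum>J\<in>\<I>. n I J * (n I J - 1))"
    by (simp only: sum.distrib sum_distrib_left)
  also have "(\<Sum>I\<in>\<I>. \<Sum>J\<in>\<I>. n I J) = m * (real ((m - 1) choose (r - 1)))\<^sup>2"
    using sum_card_Int_subsets(1)[of "{1..m}" r] r by (simp add: n_def \<I>_def)
  also have "(\<Sum>I\<in>\<I>. \<Sum>J\<in>\<I>. n I J * (n I J - 1)) = m * real (m - 1) * (real ((m - 2) choose (r - 2)))\<^sup>2"
    using sum_card_Int_subsets(2)[of "{1..m}" r] r by (simp add: n_def \<I>_def)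
  finally show ?thesis
    by (simp add: expectation_linear_part_square[OF r] mult_ac)
qed

end

section \<open>The limit theorem\<close>

text \<open>
  The first summand is the price of replacing the gcd sum by its linear part, the second that of the
  central limit theorem for the linear part; \<open>q\<close> stands for \<open>N\<^sup>2 / m\<close>.
\<close>
definition char_error :: "nat \<Rightarrow> real \<Rightarrow> real \<Rightarrow> real" where
  "char_error r t q = \<bar>t\<bar> * sqrt (8 * (real (r - 1))\<^sup>2 * 9 ^ (r - 1) * q) + \<bar>t\<bar> ^ 3 * sqrt (8 * 9 ^ (r - 1) * q) / 6"

context uniform_sequence
begin

text \<open>
  The variables take values in \<open>{1..N}\<close> only almost surely, so the gcd sum and its bounded
  version may differ on a null set.
\<close>
lemma gcd_sum_AE_eq:
  assumes r: "r \<ge> 1"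
  shows "AE \<omega> in M. gcd_sum X m r \<omega> = (\<Sum>I | I \<subseteq> {1..m} \<and> card I = r. gcd_kernel N I (\<lambda>i. X i \<omega>))"
proof -
  have "AE \<omega> in M. \<forall>i\<in>{1..m}. X i \<omega> \<in> {1..N}"
    by (intro AE_finite_allI AE_X_range) auto
  then show ?thesis
  proof (rule AE_mp, intro AE_I2 impI)
    fix \<omega> assume range: "\<forall>i\<in>{1..m}. X i \<omega> \<in> {1..N}"
    show "gcd_sum X m r \<omega> = (\<Sum>I | I \<subseteq> {1..m} \<and> card I = r. gcd_kernel N I (\<lambda>i. X i \<omega>))"
      unfolding gcd_sum_def
    proof (rule sum.cong[OF refl])
      fix I assume "I \<in> {I. I \<subseteq> {1..m} \<and> card I = r}"
      then have I: "I \<subseteq> {1..m}" "card I = r" by auto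
      then obtain i where "i \<in> I" using r by (cases "I = {}") auto
      then show "real (GCD i\<in>I. X i \<omega>) = gcd_kernel N I (\<lambda>i. X i \<omega>)"
        using I range by (intro gcd_kernel_eq_Gcd[symmetric]) (auto intro: finite_subset)
    qed
  qed
qed

lemma gcd_sum_measurable: "random_variable borel (gcd_sum X m r)"
proof -
  have Gcd: "(\<lambda>\<omega>. GCD i\<in>I. X i \<omega>) \<in> measurable M (count_space UNIV)"
    if "finite I" "I \<subseteq> {1..m}" for I
    using that
  proof (induction I rule: finite_induct)
    case (insert i I)
    then have "(\<lambda>\<omega>. (X i \<omega>, GCD i\<in>I. X i \<omega>)) \<in> measurable M (count_space UNIV \<Otimes>\<^sub>M count_space UNIV)"
      by (intro measurable_Pair X_measurable) auto
    moreover have "(\<lambda>p. gcd (fst p) (snd p)) \<in> measurable (count_space UNIV \<Otimes>\<^sub>M count_space UNIV) (count_space (UNIV :: nat set))"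
      by (simp add: pair_measure_countable)
    ultimately have "(\<lambda>\<omega>. gcd (fst (X i \<omega>, GCD i\<in>I. X i \<omega>)) (snd (X i \<omega>, GCD i\<in>I. X i \<omega>))) \<in> measurable M (count_space UNIV)"
      by (rule measurable_compose)
    then show ?case by simp
  qed simp
  have "random_variable borel (\<lambda>\<omega>. real (GCD i\<in>I. X i \<omega>))" if "I \<subseteq> {1..m}" for I
    using that by (intro measurable_compose[OF Gcd]) (auto intro: finite_subset)
  then show ?thesis
    unfolding gcd_sum_def by (intro borel_measurable_sum) auto
qed

lemma distr_normalized_gcd_sum:
  assumes r: "r \<ge> 1"
  shows "distr M borel (\<lambda>\<omega>. (gcd_sum X m r \<omega> - expectation (gcd_sum X m r)) / sqrt (variance (gcd_sum X m r)))
    = distr M borel (\<lambda>\<omega>. centered_gcd_sum m r \<omega> / sqrt (expectation (\<lambda>\<omega>. (centered_gcd_sum m r \<omega>)\<^sup>2)))"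
proof -
  define \<I> where "\<I> = {I. I \<subseteq> {1..m} \<and> card I = r}"
  have k: "bounded_rv (\<lambda>\<omega>. gcd_kernel N I (\<lambda>i. X i \<omega>))" if "I \<in> \<I>" for I
    using that by (intro bounded_rv_gcd_kernel) (auto simp: \<I>_def)
  have meas_k: "random_variable borel (\<lambda>\<omega>. \<Sum>I\<in>\<I>. gcd_kernel N I (\<lambda>i. X i \<omega>))"
    by (intro bounded_rv_measurable bounded_rv_sum k)
  have meas_c: "random_variable borel (centered_gcd_sum m r)"
    by (intro bounded_rv_measurable bounded_rv_centered_gcd_sum)
  note AE = gcd_sum_AE_eq[OF r, of m, folded \<I>_def]
  have "expectation (gcd_sum X m r) = expectation (\<lambda>\<omega>. \<Sum>I\<in>\<I>. gcd_kernel N I (\<lambda>i. X i \<omega>))"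
    by (rule integral_cong_AE[OF gcd_sum_measurable meas_k AE])
  also have "\<dots> = (\<Sum>I\<in>\<I>. expectation (\<lambda>\<omega>. gcd_kernel N I (\<lambda>i. X i \<omega>)))"
    by (rule expectation_sum_bounded) (rule k)
  also have "\<dots> = (\<Sum>I\<in>\<I>. gcd_mean N r)"
  proof (rule sum.cong[OF refl])
    fix I assume "I \<in> \<I>"
    then have "finite I" "I \<subseteq> {1..}" "card I = r"
      by (auto simp: \<I>_def intro: finite_subset)
    then show "expectation (\<lambda>\<omega>. gcd_kernel N I (\<lambda>i. X i \<omega>)) = gcd_mean N r"
      using expectation_gcd_kernel[of I] by simp
  qed
  finally have mean: "expectation (gcd_sum X m r) = (\<Sum>I\<in>\<I>. gcd_mean N r)" .
  have AE': "AE \<omega> in M. gcd_sum X m r \<omega> - expectation (gcd_sum X m r) = centered_gcd_sum m r \<omega>"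
    using AE by eventually_elim (simp add: mean centered_gcd_sum_def \<I>_def sum_subtractf)
  have "variance (gcd_sum X m r) = expectation (\<lambda>\<omega>. (centered_gcd_sum m r \<omega>)\<^sup>2)"
  proof (rule integral_cong_AE)
    show "AE \<omega> in M. (gcd_sum X m r \<omega> - expectation (gcd_sum X m r))\<^sup>2 = (centered_gcd_sum m r \<omega>)\<^sup>2"
      using AE' by eventually_elim simp
  qed (intro borel_measurable_power borel_measurable_diff borel_measurable_const gcd_sum_measurable meas_c)+
  then have eq: "AE \<omega> in M. (gcd_sum X m r \<omega> - expectation (gcd_sum X m r)) / sqrt (variance (gcd_sum X m r))
     = centered_gcd_sum m r \<omega> / sqrt (expectation (\<lambda>\<omega>. (centered_gcd_sum m r \<omega>)\<^sup>2))"
    using AE' by (elim AE_mp) (intro AE_I2, simp)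
  show ?thesis
    by (rule distr_cong_AE[OF refl refl eq])
       (intro borel_measurable_divide borel_measurable_diff borel_measurable_const gcd_sum_measurable meas_c)+
qed

lemma char_linear_part_approx:
  assumes r: "r \<ge> 3" and m: "m \<ge> r" and var: "gcd_proj_var N r > 0" and t: "t\<^sup>2 \<le> 4 * m"
  shows "cmod (char (distr M borel (\<lambda>\<omega>. linear_part m r \<omega> / sqrt (expectation (\<lambda>\<omega>. (linear_part m r \<omega>)\<^sup>2)))) t
            - complex_of_real ((1 + (- t\<^sup>2 / 2) / m) ^ m))
         \<le> \<bar>t\<bar> ^ 3 * (2 * sqrt N / sqrt (m * gcd_proj_var N r)) / 6"
proof -
  define s where "s = sqrt (m * gcd_proj_var N r)"
  define Y where "Y i \<omega> = (gcd_proj N r (X i \<omega>) - gcd_mean N r) / s" for i \<omega>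
  have s: "s > 0" "s\<^sup>2 = m * gcd_proj_var N r" using r m var by (auto simp: s_def)
  have c: "real ((m - 1) choose (r - 1)) > 0" using r m by (simp add: zero_less_binomial_iff)
  have eq: "linear_part m r \<omega> / sqrt (expectation (\<lambda>\<omega>. (linear_part m r \<omega>)\<^sup>2)) = (\<Sum>i\<in>{1..m}. Y i \<omega>)" for \<omega>
  proof -
    have "sqrt (expectation (\<lambda>\<omega>. (linear_part m r \<omega>)\<^sup>2)) = real ((m - 1) choose (r - 1)) * s"
      by (simp add: expectation_linear_part_square[OF r] s_def real_sqrt_mult)
    then show ?thesis
      using c by (simp add: linear_part_def Y_def sum_divide_distrib)
  qed
  have "cmod (char (distr M borel (\<lambda>\<omega>. \<Sum>i\<in>{1..m}. Y i \<omega>)) t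
            - complex_of_real ((1 + (- t\<^sup>2 / 2) / card {1..m}) ^ card {1..m})) \<le> \<bar>t\<bar> ^ 3 * (2 * sqrt N / s) / 6"
  proof (rule char_sum_bounded_approx)
    show "indep_vars (\<lambda>_. borel) Y {1..m}"
      unfolding Y_def
      by (rule indep_vars_compose2[where Y = "\<lambda>_ x. (gcd_proj N r x - gcd_mean N r) / s",
            OF indep_vars_subset[OF indep]]) auto
  next
    fix i assume "i \<in> {1..m}"
    then have i: "i \<ge> 1" by simp
    show "expectation (Y i) = 0"
      using expectation_comp_X(1)[OF i, of "\<lambda>x. (gcd_proj N r x - gcd_mean N r) / s"] r N_pos
      by (simp add: Y_def[abs_def] avg_diff avg_const avg_gcd_proj avg_cmult[of N "1 / s", simplified])
    have "expectation (\<lambda>\<omega>. (Y i \<omega>)\<^sup>2) = expectation (\<lambda>\<omega>. (gcd_proj N r (X i \<omega>) - gcd_mean N r) * (gcd_proj N r (X i \<omega>) - gcd_mean N r)) / s\<^sup>2"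
      by (simp add: Y_def power_divide power2_eq_square)
    then show "expectation (\<lambda>\<omega>. (Y i \<omega>)\<^sup>2) = 1 / card {1..m}"
      using covariance_gcd_proj[OF r i i] var s by simp
  next
    fix i \<omega>
    show "\<bar>Y i \<omega>\<bar> \<le> 2 * sqrt N / s"
      using gcd_proj_deviation_le[OF r N_pos, of "X i \<omega>"] s
      by (simp add: Y_def divide_right_mono)
  qed (use r m t in auto)
  then show ?thesis by (simp add: eq s_def)
qed

text \<open>
  The binomial coefficients cancel by the absorption identity
  \<open>(r - 1) binom(m - 1, r - 1) = (m - 1) binom(m - 2, r - 2)\<close>.
\<close>
lemma variance_ratio_le:
  assumes r: "r \<ge> 3" and m: "m \<ge> r" and var: "gcd_proj_var N r > 0"
  shows "expectation (\<lambda>\<omega>. (centered_gcd_sum m r \<omega>)\<^sup>2) / expectation (\<lambda>\<omega>. (linear_part m r \<omega>)\<^sup>2) - 1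
    \<le> N * (real (r - 1))\<^sup>2 / (real (m - 1) * gcd_proj_var N r)"
proof -
  define b where "b = expectation (\<lambda>\<omega>. (linear_part m r \<omega>)\<^sup>2)"
  define c where "c = real ((m - 1) choose (r - 1))"
  define c' where "c' = real ((m - 2) choose (r - 2))"
  define v where "v = gcd_proj_var N r"
  have c: "c > 0" using r m by (simp add: c_def zero_less_binomial_iff)
  have b: "b = m * c\<^sup>2 * v" by (simp add: b_def c_def v_def expectation_linear_part_square[OF r])
  have pos: "real m > 0" "real (m - 1) > 0" "v > 0" using r m var by (auto simp: v_def)
  have bpos: "b > 0" using b c pos by simp
  have "real (r - 1) * c = real (m - 1) * c'"
  proof -
    have "(r - 1) * ((m - 1) choose (r - 1)) = (m - 1) * ((m - 2) choose (r - 2))"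
      using r m binomial_absorption[of "r - 2" "m - 1"]
      by (simp add: Suc_diff_Suc numeral_2_eq_2)
    then show ?thesis by (simp only: c_def c'_def of_nat_mult[symmetric])
  qed
  then have c': "c' = real (r - 1) * c / real (m - 1)" using pos by (simp add: field_simps)
  have "expectation (\<lambda>\<omega>. (centered_gcd_sum m r \<omega>)\<^sup>2) \<le> b + N * (m * real (m - 1) * c'\<^sup>2)"
    using expectation_centered_gcd_sum_square_le[OF r, of m] by (simp add: b_def c'_def)
  then have "expectation (\<lambda>\<omega>. (centered_gcd_sum m r \<omega>)\<^sup>2) / b - 1 \<le> N * (m * real (m - 1) * c'\<^sup>2) / b"
    using bpos by (simp add: divide_simps)
  also have "\<dots> = N * (real (r - 1))\<^sup>2 / (real (m - 1) * v)"
    unfolding b c' using pos c by (simp add: power_divide power_mult_distrib power2_eq_square)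
  finally show ?thesis by (simp add: b_def v_def)
qed

text \<open>
  Here the lower bound of order \<open>1/N\<close> for the projection variance turns both error terms into
  functions of \<open>N\<^sup>2 / m\<close>.
\<close>
lemma char_normalized_gcd_sum_approx:
  assumes r: "r \<ge> 3" and m: "m \<ge> r" and N: "N \<ge> 2" and t: "t\<^sup>2 \<le> 4 * m"
  shows "cmod (char (distr M borel (\<lambda>\<omega>. (gcd_sum X m r \<omega> - expectation (gcd_sum X m r)) / sqrt (variance (gcd_sum X m r)))) t
            - complex_of_real ((1 + (- t\<^sup>2 / 2) / m) ^ m)) \<le> char_error r t ((real N)\<^sup>2 / m)"
proof -
  define v where "v = gcd_proj_var N r"
  define \<kappa> :: real where "\<kappa> = 9 ^ (r - 1)"
  define a where "a = expectation (\<lambda>\<omega>. (centered_gcd_sum m r \<omega>)\<^sup>2)"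
  define b where "b = expectation (\<lambda>\<omega>. (linear_part m r \<omega>)\<^sup>2)"
  have \<kappa>: "\<kappa> > 0" by (simp add: \<kappa>_def)
  have v_ge: "v \<ge> 1 / (2 * \<kappa> * N)"
    using gcd_proj_var_ge[OF N, of r] by (simp add: v_def \<kappa>_def power_mult power_divide mult_ac)
  have "1 / (2 * \<kappa> * N) > 0" using \<kappa> N by simp
  then have v: "v > 0" using v_ge by linarith
  have inv_v: "1 / v \<le> 2 * \<kappa> * N"
    using v_ge v \<kappa> N by (simp add: field_simps)
  have mpos: "real m > 0" "real (m - 1) \<ge> real m / 2" using r m by auto
  have b: "b > 0"
    using r m v by (simp add: b_def expectation_linear_part_square[OF r] v_def zero_less_binomial_iff)
  define U where "U \<omega> = centered_gcd_sum m r \<omega> / sqrt a" for \<omega>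
  define V where "V \<omega> = linear_part m r \<omega> / sqrt b" for \<omega>
  have bdd: "bounded_rv (centered_gcd_sum m r)" "bounded_rv (linear_part m r)"
    by (rule bounded_rv_centered_gcd_sum, rule bounded_rv_linear_part[OF r])
  have UV: "integrable M (\<lambda>\<omega>. (U \<omega> - V \<omega>)\<^sup>2)" "expectation (\<lambda>\<omega>. (U \<omega> - V \<omega>)\<^sup>2) \<le> 2 * (a / b - 1)"
    unfolding U_def V_def a_def b_def
    using b expectation_centered_gcd_sum_linear_part[OF r]
    by (intro normalized_projection_distance bounded_rv_integrable bounded_rv_intros bdd; simp add: b_def)+
  have [measurable]: "random_variable borel U" "random_variable borel V"
    unfolding U_def V_def using bdd[THEN bounded_rv_measurable] by measurable
  have "expectation (\<lambda>\<omega>. (U \<omega> - V \<omega>)\<^sup>2) \<le> 8 * (real (r - 1))\<^sup>2 * \<kappa> * ((real N)\<^sup>2 / m)"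
  proof -
    have "a / b - 1 \<le> N * (real (r - 1))\<^sup>2 / (real (m - 1) * v)"
      unfolding a_def b_def v_def using r m v by (intro variance_ratio_le) (auto simp: v_def)
    also have "\<dots> = N * (real (r - 1))\<^sup>2 * (1 / real (m - 1)) * (1 / v)" by simp
    also have "\<dots> \<le> N * (real (r - 1))\<^sup>2 * (2 / m) * (2 * \<kappa> * N)"
    proof (intro mult_mono mult_left_mono)
      show "1 / real (m - 1) \<le> 2 / real m" using mpos by (simp add: divide_simps)
    qed (use inv_v v \<kappa> mpos in auto)
    also have "\<dots> = 4 * (real (r - 1))\<^sup>2 * \<kappa> * ((real N)\<^sup>2 / m)" by (simp add: power2_eq_square)
    finally show ?thesis using UV(2) by simp
  qed
  then have "\<bar>t\<bar> * sqrt (expectation (\<lambda>\<omega>. (U \<omega> - V \<omega>)\<^sup>2)) \<le> \<bar>t\<bar> * sqrt (8 * (real (r - 1))\<^sup>2 * \<kappa> * ((real N)\<^sup>2 / m))"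
    by (intro mult_left_mono real_sqrt_le_mono) auto
  then have 1: "cmod (char (distr M borel U) t - char (distr M borel V) t) \<le> \<bar>t\<bar> * sqrt (8 * (real (r - 1))\<^sup>2 * \<kappa> * ((real N)\<^sup>2 / m))"
    using char_distr_diff_le[of U V t] UV(1) by simp
  have "2 * sqrt N / sqrt (m * v) = sqrt (4 * N / m * (1 / v))"
    by (simp add: real_sqrt_mult real_sqrt_divide)
  also have "\<dots> \<le> sqrt (4 * N / m * (2 * \<kappa> * N))"
    using inv_v by (intro real_sqrt_le_mono mult_left_mono) auto
  also have "\<dots> = sqrt (8 * \<kappa> * ((real N)\<^sup>2 / m))" by (simp add: power2_eq_square mult_ac)
  finally have "\<bar>t\<bar> ^ 3 * (2 * sqrt N / sqrt (m * v)) / 6 \<le> \<bar>t\<bar> ^ 3 * sqrt (8 * \<kappa> * ((real N)\<^sup>2 / m)) / 6"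
    by (intro divide_right_mono mult_left_mono) auto
  moreover have "cmod (char (distr M borel V) t - complex_of_real ((1 + (- t\<^sup>2 / 2) / m) ^ m))
      \<le> \<bar>t\<bar> ^ 3 * (2 * sqrt N / sqrt (m * v)) / 6"
    unfolding V_def[abs_def] b_def v_def
    using char_linear_part_approx[OF r m _ t] v by (simp only: v_def)
  ultimately have 2: "cmod (char (distr M borel V) t - complex_of_real ((1 + (- t\<^sup>2 / 2) / m) ^ m))
      \<le> \<bar>t\<bar> ^ 3 * sqrt (8 * \<kappa> * ((real N)\<^sup>2 / m)) / 6"
    by (rule order_trans[rotated])
  have "distr M borel (\<lambda>\<omega>. (gcd_sum X m r \<omega> - expectation (gcd_sum X m r)) / sqrt (variance (gcd_sum X m r)))
      = distr M borel U"
    using distr_normalized_gcd_sum[of r m] r by (simp add: U_def[abs_def] a_def)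
  moreover have "cmod (char (distr M borel U) t - complex_of_real ((1 + (- t\<^sup>2 / 2) / m) ^ m))
      \<le> cmod (char (distr M borel U) t - char (distr M borel V) t)
        + cmod (char (distr M borel V) t - complex_of_real ((1 + (- t\<^sup>2 / 2) / m) ^ m))"
    using norm_triangle_ineq[of "char (distr M borel U) t - char (distr M borel V) t"
        "char (distr M borel V) t - complex_of_real ((1 + (- t\<^sup>2 / 2) / m) ^ m)"] by simp
  ultimately show ?thesis
    using 1 2 unfolding char_error_def \<kappa>_def[symmetric] by simp
qed

end

lemma tendsto_square_over_index:
  fixes n :: "nat \<Rightarrow> nat" and \<beta> :: real
  assumes "\<beta> < 1 / 2" and "eventually (\<lambda>m. real (n m) \<le> real m powr \<beta>) sequentially"
  shows "(\<lambda>m. (real (n m))\<^sup>2 / m) \<longlonglongrightarrow> 0"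
proof (rule tendsto_sandwich)
  show "(\<lambda>_. 0) \<longlonglongrightarrow> (0::real)" by simp
  show "(\<lambda>m. real m powr (2 * \<beta> - 1)) \<longlonglongrightarrow> 0"
    using assms(1) by (intro tendsto_neg_powr filterlim_real_sequentially) auto
  show "\<forall>\<^sub>F m in sequentially. 0 \<le> (real (n m))\<^sup>2 / real m" by simp
  show "\<forall>\<^sub>F m in sequentially. (real (n m))\<^sup>2 / real m \<le> real m powr (2 * \<beta> - 1)"
    using assms(2) eventually_gt_at_top[of 0]
  proof eventually_elim
    case (elim m)
    have "(real (n m))\<^sup>2 / m \<le> (real m powr \<beta>)\<^sup>2 / m"
      using elim by (intro divide_right_mono power_mono) auto
    also have "\<dots> = real m powr (2 * \<beta> - 1)"
      using elim by (simp add: powr_diff power2_eq_square powr_add[symmetric])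
    finally show ?case .
  qed
qed

theorem theorem5p2:
  fixes M :: "'a measure"
    and X :: "nat \<Rightarrow> nat \<Rightarrow> 'a \<Rightarrow> nat"
    and r :: nat
    and \<beta> :: real
    and n :: "nat \<Rightarrow> nat"
  assumes "prob_space M"
    and "\<And>N. N \<ge> 1 \<Longrightarrow> prob_space.indep_vars M (\<lambda>i. count_space UNIV) (X N) {1..}"
    and "\<And>N i. N \<ge> 1 \<Longrightarrow> i \<ge> 1 \<Longrightarrow>
           distr M (count_space UNIV) (X N i) = measure_pmf (pmf_of_set {1..N})"
    and "r \<ge> 3"
    and "\<beta> < 1 / 2"
    and "\<And>m. m \<ge> 1 \<Longrightarrow> n m \<ge> 2"
    and "eventually (\<lambda>m. real (n m) \<le> real m powr \<beta>) sequentially"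
  shows "weak_conv_m
           (\<lambda>m. distr M borel
              (\<lambda>\<omega>. (gcd_sum (X (n m)) m r \<omega> - prob_space.expectation M (gcd_sum (X (n m)) m r))
                    / sqrt (prob_space.variance M (gcd_sum (X (n m)) m r))))
           std_normal_distribution"
proof -
  interpret prob_space M by fact
  have unif: "uniform_sequence M (X (n m)) (n m)" if "m \<ge> 1" for m
  proof
    have "n m \<ge> 1" using assms(6)[OF that] by simp
    then show "1 \<le> n m" "indep_vars (\<lambda>_. count_space UNIV) (X (n m)) {1..}"
      "\<And>i. 1 \<le> i \<Longrightarrow> distr M (count_space UNIV) (X (n m) i) = measure_pmf (pmf_of_set {1..n m})"
      using assms(2,3) by auto
  qed
  define D where "D m = distr M borel (\<lambda>\<omega>. (gcd_sum (X (n m)) m r \<omega> - expectation (gcd_sum (X (n m)) m r))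
                    / sqrt (variance (gcd_sum (X (n m)) m r)))" for m
  have "weak_conv_m D std_normal_distribution"
  proof (rule levy_continuity)
    fix m
    have [measurable]: "random_variable borel (gcd_sum (X (n m)) m r)"
    \<comment> \<open>Nothing is known about \<open>n 0\<close>, hence about the variables of row 0, but that gcd sum is empty.\<close>
    proof (cases "m \<ge> 1")
      case True
      then show ?thesis by (rule uniform_sequence.gcd_sum_measurable[OF unif])
    next
      case False
      then have "gcd_sum (X (n m)) m r = (\<lambda>_. 0)"
        using assms(4) by (auto simp: gcd_sum_def fun_eq_iff intro!: sum.neutral)
      then show ?thesis by simp
    qed
    show "real_distribution (D m)"
      unfolding D_def by (rule real_distribution_distr) measurable
  next
    fix t :: real
    define z where "z m = complex_of_real ((1 + (- t\<^sup>2 / 2) / real m) ^ m)" for m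
    have z: "z \<longlonglongrightarrow> complex_of_real (exp (- t\<^sup>2 / 2))"
      unfolding z_def by (intro tendsto_of_real tendsto_exp_limit_sequentially)
    have bound: "\<forall>\<^sub>F m in sequentially. cmod (char (D m) t - z m) \<le> char_error r t ((real (n m))\<^sup>2 / m)"
      using eventually_ge_at_top[of "max r (nat \<lceil>t\<^sup>2\<rceil>)"]
    proof eventually_elim
      case (elim m)
      have "t\<^sup>2 \<le> real (nat \<lceil>t\<^sup>2\<rceil>)" by linarith
      then have "t\<^sup>2 \<le> 4 * real m" using elim by linarith
      moreover have "m \<ge> 1" "m \<ge> r" using elim assms(4) by auto
      ultimately show ?case
        unfolding D_def z_def using assms(4,6)
        by (intro uniform_sequence.char_normalized_gcd_sum_approx unif) auto
    qed
    have "(\<lambda>m. char_error r t ((real (n m))\<^sup>2 / m)) \<longlonglongrightarrow> char_error r t 0"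
      unfolding char_error_def
      by (intro tendsto_intros tendsto_square_over_index[OF assms(5,7)]) simp_all
    then have "(\<lambda>m. char_error r t ((real (n m))\<^sup>2 / m)) \<longlonglongrightarrow> 0"
      by (simp add: char_error_def)
    then have "(\<lambda>m. char (D m) t - z m) \<longlonglongrightarrow> 0"
      by (rule Lim_null_comparison[OF bound])
    then show "(\<lambda>m. char (D m) t) \<longlonglongrightarrow> char std_normal_distribution t"
      using Lim_transform[OF z] by (simp add: char_std_normal_distribution)
  qed (rule real_dist_normal_dist)
  then show ?thesis by (simp only: D_def[abs_def])
qed

end
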